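(* Let $(\Delta_n)_{n\in\mathbb{N}}$ be an i.i.d. family of centered real random variables, $X_n:=\sum_{i=1}^n\Delta_i$, and $n_0\in\mathbb{N}$. Assume $p>3$ and $\mathbb{E}[|\Delta_1|^p]<\infty$. For $\eta>0$ and $\alpha>1$ let $\varepsilon_n(\alpha,\eta,p):=\eta\,n^{\frac\alpha p-1}$, and for fixed $\varepsilon>0$ let $\mathcal{O}_{\epsilon,n_0},\mathbf{m}_{\epsilon,n_0},\tilde{\mathcal{O}}_{\varepsilon,n_0},\tilde{\mathbf{m}}_{\varepsilon,n_0}$ be as in the context. (a) For any $\eta>0$, any $\alpha>3$ with $\frac12<\frac\alpha p\leq1$ and any $0\leq\tilde p<\alpha-3$ there is a constant $C>0$ such that $$\sum_{n=n_0}^\infty n^{\tilde p}\sum_{m=n}^\infty\mathbb{P}\Big(\frac{|X_m|}{m}>\varepsilon_m(\alpha,\eta,p)\Big)\leq C(\alpha-1)\,\zeta(\alpha-2-\tilde p,n_0)<\infty,$$ $$\lim_{n\to\infty}\Big|\frac{X_n}{n}\Big|\cdot\big(\eta\,n^{\frac\alpha p-1}\big)^{-1}=0\qquad\mathbb{P}\text{-a.s.},$$ $$\mathbb{E}[\mathcal{O}_{\epsilon,n_0}^{1+\tilde p}]\leq\mathbb{E}[\mathbf{m}_{\epsilon,n_0}^{1+\tilde p}]\leq C(\alpha-1)\,\zeta(\alpha-2-\tilde p,n_0),$$ and $$\mathbb{P}(\mathcal{O}_{\epsilon,n_0}\geq k)\leq\mathbb{P}(\mathbf{m}_{\epsilon,n_0}\geq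 k)\leq k^{-(1+\tilde p)}\,C(\alpha-1)\,\zeta(\alpha-2-\tilde p,n_0),\qquad k\geq1.$$ (b) For any $\varepsilon>0$, any $\alpha>2$ with $\frac12<\frac\alpha p\leq1$ and any $0\leq\tilde p<\alpha-2$ there is a constant $C>0$ such that $$\sum_{n=1}^\infty n^{\tilde p}\,\mathbb{P}\Big(\max_{k\geq n}\frac{|X_k|}{k^{\frac\alpha p}}>\varepsilon\Big)\leq C\,\zeta(\alpha-1-\tilde p,n_0)<\infty,$$ $$\lim_{n\to\infty}\max_{k\geq n}\frac{|X_k|}{k^{\frac\alpha p}}\leq\varepsilon\qquad\mathbb{P}\text{-a.s.},$$ $$\mathbb{E}[\tilde{\mathcal{O}}_{\varepsilon,n_0}^{1+\tilde p}]\leq\mathbb{E}[\tilde{\mathbf{m}}_{\varepsilon,n_0}^{1+\tilde p}]\leq C\,\zeta(\alpha-1-\tilde p,n_0)<\infty,$$ and $$\mathbb{P}(\tilde{\mathcal{O}}_{\varepsilon,n_0}\geq k)\leq\mathbb{P}(\tilde{\mathbf{m}}_{\varepsilon,n_0}\geq k)\leq k^{-(\tilde p+1)}\,C\,\zeta(\alpha-1-\tilde p,n_0),\qquad k\geq1.$$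
   Context: $\mathbb{N}=\{1,2,\dots\}$. $\zeta(z,n_0):=\sum_{n=n_0}^\infty n^{-z}$ is the Hurwitz zeta function. $$\mathcal{O}_{\epsilon,n_0}:=\sum_{n=n_0}^\infty\mathbf{1}\Big\{\frac{|X_n|}{n}>\varepsilon_n(\alpha,\eta,p)\Big\},\qquad\mathbf{m}_{\epsilon,n_0}:=\max\Big\{n\geq n_0:\frac{|X_n|}{n}>\varepsilon_n(\alpha,\eta,p)\Big\},$$ $$\tilde{\mathcal{O}}_{\varepsilon,n_0}:=\sum_{n=n_0}^\infty\mathbf{1}\Big\{\max_{k\geq n}\frac{|X_k|}{k^{\alpha/p}}>\varepsilon\Big\},\qquad\tilde{\mathbf{m}}_{\varepsilon,n_0}:=\max\Big\{n\geq n_0:\max_{k\geq n}\frac{|X_k|}{k^{\alpha/p}}>\varepsilon\Big\}.$$ The maximum over the empty set of indices is $0$ (and $\infty$ over an unbounded set of indices); $\max_{k\ge n}$ is read as a supremum. The constants $C$ may depend on $\alpha,p,\tilde p,\eta$ (resp. $\varepsilon$), $n_0$ and the law of $\Delta_1$, but not on $k$. *)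

theory Defs
  imports "HOL-Probability.Probability"
begin

(* For real exponents only, as an element of [0,\<infinity>], so that finiteness of the series is a
   genuine claim. *)
definition hurwitz_zeta :: "real \<Rightarrow> nat \<Rightarrow> ennreal" where
  "hurwitz_zeta z n\<^sub>0 = (\<Sum>\<^sub>\<infinity>n\<in>{n\<^sub>0..}. ennreal (real n powr (- z)))"

(* Only meaningful for a > 0. *)
definition ennreal_powr :: "ennreal \<Rightarrow> real \<Rightarrow> ennreal" where
  "ennreal_powr x a = (if x = \<infinity> then \<infinity> else ennreal (enn2real x powr a))"

definition partial_sum :: "(nat \<Rightarrow> 'a \<Rightarrow> real) \<Rightarrow> nat \<Rightarrow> 'a \<Rightarrow> real" where
  "partial_sum \<Delta> n \<omega> = (\<Sum>i\<in>{1..n}. \<Delta> i \<omega>)"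

definition tolerance :: "real \<Rightarrow> real \<Rightarrow> real \<Rightarrow> nat \<Rightarrow> real" where
  "tolerance \<alpha> \<eta> p n = \<eta> * real n powr (\<alpha> / p - 1)"

(* The maximum over k \<ge> n, read as a supremum in [0,\<infinity>]. *)
definition tail_max :: "(nat \<Rightarrow> 'a \<Rightarrow> real) \<Rightarrow> real \<Rightarrow> real \<Rightarrow> nat \<Rightarrow> 'a \<Rightarrow> ennreal" where
  "tail_max X \<alpha> p n \<omega> = (SUP k\<in>{n..}. ennreal (\<bar>X k \<omega>\<bar> / real k powr (\<alpha> / p)))"

definition count_from :: "nat \<Rightarrow> (nat \<Rightarrow> bool) \<Rightarrow> ennreal" where
  "count_from n\<^sub>0 P = (\<Sum>\<^sub>\<infinity>n\<in>{n\<^sub>0..}. of_bool (P n))"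

(* In ennreal the supremum is 0 for the empty set, the maximum for a finite nonempty set, and
   \<infinity> for an unbounded set of indices. *)
definition max_from :: "nat \<Rightarrow> (nat \<Rightarrow> bool) \<Rightarrow> ennreal" where
  "max_from n\<^sub>0 P = (SUP n\<in>{n. n \<ge> n\<^sub>0 \<and> P n}. of_nat n)"

definition overlap_count ::
  "(nat \<Rightarrow> 'a \<Rightarrow> real) \<Rightarrow> real \<Rightarrow> real \<Rightarrow> real \<Rightarrow> nat \<Rightarrow> 'a \<Rightarrow> ennreal" where
  "overlap_count X \<alpha> \<eta> p n\<^sub>0 \<omega> =
     count_from n\<^sub>0 (\<lambda>n. \<bar>X n \<omega>\<bar> / real n > tolerance \<alpha> \<eta> p n)"

definition last_overlap ::
  "(nat \<Rightarrow> 'a \<Rightarrow> real) \<Rightarrow> real \<Rightarrow> real \<Rightarrow> real \<Rightarrow> nat \<Rightarrow> 'a \<Rightarrow> ennreal" where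
  "last_overlap X \<alpha> \<eta> p n\<^sub>0 \<omega> =
     max_from n\<^sub>0 (\<lambda>n. \<bar>X n \<omega>\<bar> / real n > tolerance \<alpha> \<eta> p n)"

definition tail_overlap_count ::
  "(nat \<Rightarrow> 'a \<Rightarrow> real) \<Rightarrow> real \<Rightarrow> real \<Rightarrow> real \<Rightarrow> nat \<Rightarrow> 'a \<Rightarrow> ennreal" where
  "tail_overlap_count X \<alpha> p \<epsilon> n\<^sub>0 \<omega> =
     count_from n\<^sub>0 (\<lambda>n. tail_max X \<alpha> p n \<omega> > ennreal \<epsilon>)"

definition last_tail_overlap ::
  "(nat \<Rightarrow> 'a \<Rightarrow> real) \<Rightarrow> real \<Rightarrow> real \<Rightarrow> real \<Rightarrow> nat \<Rightarrow> 'a \<Rightarrow> ennreal" where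
  "last_tail_overlap X \<alpha> p \<epsilon> n\<^sub>0 \<omega> =
     max_from n\<^sub>0 (\<lambda>n. tail_max X \<alpha> p n \<omega> > ennreal \<epsilon>)"

end

theory Submission
  imports Defs
begin

text \<open>
  Put \<open>g = \<alpha> / p\<close>. On the event that the first \<open>k\<close> increments do not exceed \<open>d k\<^sup>g\<close>, a Chernoff bound
  with parameter \<open>h\<close> proportional to \<open>ln k / k\<^sup>g\<close> shows that \<open>\<bar>X k\<bar> > \<delta> k\<^sup>g\<close> has probability of order
  \<open>k powr (- \<alpha>)\<close>; this needs only a finite variance, and \<open>g > 1/2\<close> makes the quadratic term
  bounded. A single increment exceeds \<open>d k\<^sup>g\<close> with probability of the same order by Markov's inequality
  for the \<open>p\<close>-th moment. Since the truncated bound is summable in \<open>k\<close> at the same rate as the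
  increment bound, the supremum over \<open>k \<ge> n\<close> is handled by a plain union bound, without a maximal
  inequality. Both parts then reduce to the finiteness of a series of powers, because a positive zeta
  value can absorb any finite quantity into the constant \<open>C\<close>.
\<close>

section \<open>Series in the extended nonnegative reals\<close>

text \<open>The definitions sum over index sets \<open>{n..}\<close>; written as series over all
  naturals, such sums can be interchanged with integrals and with each other.\<close>

lemma infsum_ennreal_eq_suminf:
  fixes f :: "nat \<Rightarrow> ennreal"
  shows "(\<Sum>\<^sub>\<infinity>n\<in>A. f n) = (\<Sum>n. f n * indicator A n)"
proof -
  have "(\<Sum>\<^sub>\<infinity>n\<in>A. f n) = (\<Sum>\<^sub>\<infinity>n. f n * indicator A n)"
    by (rule infsum_cong_neutral) (auto split: split_indicator)
  moreover have "((\<lambda>n. f n * indicator A n) has_sum (\<Sum>\<^sub>\<infinity>n. f n * indicator A n)) UNIV"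
    by (intro has_sum_infsum nonneg_summable_on_complete) simp
  ultimately show ?thesis
    using has_sum_imp_sums sums_unique by metis
qed

text \<open>The index 0 contributes nothing, because \<open>0 powr s = 0\<close> even for negative
  \<open>s\<close>.\<close>

lemma suminf_powr_finite:
  assumes "s < -1"
  shows "(\<Sum>n. ennreal (real n powr s)) < \<infinity>"
proof -
  have "summable (\<lambda>n. real n powr s)"
    using assms summable_real_powr_iff by blast
  then have "(\<Sum>n. ennreal (real n powr s)) = ennreal (\<Sum>n. real n powr s)"
    by (intro suminf_ennreal2) auto
  then show ?thesis
    by simp
qed

lemma hurwitz_zeta_finite:
  assumes "z > 1"
  shows "hurwitz_zeta z n\<^sub>0 < \<infinity>"
proof -
  have "hurwitz_zeta z n\<^sub>0 \<le> (\<Sum>n. ennreal (real n powr (- z)))"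
    unfolding hurwitz_zeta_def infsum_ennreal_eq_suminf
    by (intro suminf_le) (auto split: split_indicator)
  also have "\<dots> < \<infinity>"
    using assms by (intro suminf_powr_finite) simp
  finally show ?thesis .
qed

lemma hurwitz_zeta_pos:
  assumes "n\<^sub>0 \<ge> 1"
  shows "hurwitz_zeta z n\<^sub>0 > 0"
proof -
  let ?f = "\<lambda>n. ennreal (real n powr (- z)) * indicator {n\<^sub>0..} n"
  have "0 < ?f n\<^sub>0"
    using assms by simp
  also have "?f n\<^sub>0 = sum ?f {n\<^sub>0}"
    by simp
  also have "\<dots> \<le> suminf ?f"
    by (rule sum_le_suminf) auto
  finally show ?thesis
    unfolding hurwitz_zeta_def infsum_ennreal_eq_suminf .
qed

text \<open>By Tonelli, \<open>f m\<close> receives the total weight of the \<open>n\<close> in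
  \<open>{1..m}\<close>, which is at most \<open>m\<close> times the largest weight
  \<open>m powr q\<close>. Passing to tail sums therefore costs one power of the index.\<close>

lemma suminf_powr_tail_le:
  fixes f :: "nat \<Rightarrow> ennreal"
  assumes "0 \<le> q"
  shows "(\<Sum>n. ennreal (real n powr q) * indicator {1..} n * (\<Sum>m. f m * indicator {n..} m))
    \<le> (\<Sum>m. ennreal (real m powr (1 + q)) * f m)"
proof -
  let ?g = "\<lambda>n m. ennreal (real n powr q) * indicator {1..} n * (f m * indicator {n..} m)"
  have "(\<Sum>n. ennreal (real n powr q) * indicator {1..} n * (\<Sum>m. f m * indicator {n..} m))
      = (\<Sum>n. \<Sum>m. ?g n m)"
    by simp
  \<comment> \<open>Reading the outer series as an integral over the counting measure makes the
    interchange an instance of integrating a series termwise.\<close>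
  also have "\<dots> = (\<Sum>m. \<Sum>n. ?g n m)"
    unfolding nn_integral_count_space_nat[symmetric, of "\<lambda>n. \<Sum>m. ?g n m"]
    by (subst nn_integral_suminf) (auto simp: nn_integral_count_space_nat)
  also have "\<dots> \<le> (\<Sum>m. ennreal (real m powr (1 + q)) * f m)"
  proof (intro suminf_le)
    fix m
    have "(\<Sum>n. ?g n m) = (\<Sum>n\<in>{1..m}. ?g n m)"
      by (rule suminf_finite) (auto split: split_indicator)
    also have "\<dots> = (\<Sum>n\<in>{1..m}. ennreal (real n powr q)) * f m"
      by (simp add: sum_distrib_right del: sum_ennreal)
    also have "(\<Sum>n\<in>{1..m}. ennreal (real n powr q)) \<le> (\<Sum>n\<in>{1..m}. ennreal (real m powr q))"
      using assms by (intro sum_mono ennreal_leI powr_mono2) auto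
    also have "\<dots> = ennreal (real m powr (1 + q))"
      by (simp add: powr_add ennreal_mult ennreal_of_nat_eq_real_of_nat)
    finally show "(\<Sum>n. ?g n m) \<le> ennreal (real m powr (1 + q)) * f m"
      by (simp add: mult_right_mono)
  qed auto
  finally show ?thesis .
qed

lemma infsum_tails_le:
  fixes f :: "nat \<Rightarrow> ennreal"
  assumes "0 \<le> q" "n\<^sub>0 \<ge> 1"
  shows "(\<Sum>\<^sub>\<infinity>n\<in>{n\<^sub>0..}. ennreal (real n powr q) * (\<Sum>\<^sub>\<infinity>m\<in>{n..}. f m))
    \<le> (\<Sum>m. ennreal (real m powr (1 + q)) * f m)"
proof -
  have "(\<Sum>\<^sub>\<infinity>n\<in>{n\<^sub>0..}. ennreal (real n powr q) * (\<Sum>\<^sub>\<infinity>m\<in>{n..}. f m))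
      \<le> (\<Sum>n. ennreal (real n powr q) * indicator {1..} n * (\<Sum>m. f m * indicator {n..} m))"
    unfolding infsum_ennreal_eq_suminf using assms(2)
    by (intro suminf_le) (auto split: split_indicator)
  also have "\<dots> \<le> (\<Sum>m. ennreal (real m powr (1 + q)) * f m)"
    by (rule suminf_powr_tail_le[OF assms(1)])
  finally show ?thesis .
qed

text \<open>Source of the constant \<open>C\<close> in both parts. The summand 1 in the witness
  keeps \<open>C\<close> positive when \<open>S = 0\<close>; for an infinite \<open>z\<close> any
  positive \<open>C\<close> works.\<close>

lemma obtain_ennreal_factor:
  fixes S z :: ennreal
  assumes "S < \<infinity>" "0 < z" "0 < c"
  obtains C where "0 < C" "S \<le> ennreal (C * c) * z"
proof (cases "z = \<infinity>")
  case True
  then show ?thesis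
    using assms by (intro that[of 1]) (auto simp: ennreal_mult_top)
next
  case False
  obtain s where s: "0 \<le> s" "S = ennreal s"
    using assms(1) by (cases S) auto
  obtain x where x: "0 < x" "z = ennreal x"
    using assms(2) False by (cases z) auto
  have "s \<le> (s / (c * x) + 1) * c * x"
    using s x assms(3) by (simp add: field_simps)
  then have "S \<le> ennreal ((s / (c * x) + 1) * c) * z"
    using s x assms(3) by (simp add: ennreal_leI flip: ennreal_mult)
  then show ?thesis
    using s x assms(3) by (intro that[of "s / (c * x) + 1"]) (auto intro!: add_nonneg_pos)
qed

lemma ennreal_mult_finite: "x < \<infinity> \<Longrightarrow> ennreal c * x < \<infinity>"
  by (simp add: ennreal_mult_less_top)

section \<open>Numbers of exceedances and last exceedances\<close>

text \<open>In the definition the index set depends on the sample point. A supremum over a fixed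
  countable index set makes measurability immediate.\<close>

lemma max_from_eq_SUP:
  "max_from n\<^sub>0 P = (SUP n. if n \<ge> n\<^sub>0 \<and> P n then of_nat n else 0)"
proof (rule antisym)
  show "max_from n\<^sub>0 P \<le> (SUP n. if n \<ge> n\<^sub>0 \<and> P n then of_nat n else 0)"
    unfolding max_from_def
  proof (rule SUP_least)
    fix n assume "n \<in> {n. n \<ge> n\<^sub>0 \<and> P n}"
    then show "of_nat n \<le> (SUP n. if n \<ge> n\<^sub>0 \<and> P n then of_nat n else 0 :: ennreal)"
      by (intro SUP_upper2[of n]) auto
  qed
  show "(SUP n. if n \<ge> n\<^sub>0 \<and> P n then of_nat n else 0) \<le> max_from n\<^sub>0 P"
    unfolding max_from_def by (rule SUP_least) (auto intro!: SUP_upper)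
qed

text \<open>Case rule that replaces the supremum by an attained maximum. In the finite case
  \<open>m = 0\<close> also stands for the empty set, so \<open>P m\<close> is guaranteed only for
  \<open>m \<noteq> 0\<close>.\<close>

lemma max_from_cases:
  obtains (fin) m where "max_from n\<^sub>0 P = of_nat m" "m = 0 \<or> m \<ge> n\<^sub>0 \<and> P m"
      "\<And>n. n \<ge> n\<^sub>0 \<Longrightarrow> P n \<Longrightarrow> n \<le> m"
  | (inf) "max_from n\<^sub>0 P = \<infinity>" "infinite {n. n \<ge> n\<^sub>0 \<and> P n}"
proof (cases "finite {n. n \<ge> n\<^sub>0 \<and> P n}")
  case True
  show thesis
  proof (cases "{n. n \<ge> n\<^sub>0 \<and> P n} = {}")
    case True
    then have "max_from n\<^sub>0 P = of_nat 0"
      unfolding max_from_def by (metis SUP_empty bot_ennreal of_nat_0)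
    with True show ?thesis
      by (intro fin[of 0]) auto
  next
    case False
    let ?m = "Max {n. n \<ge> n\<^sub>0 \<and> P n}"
    have m: "?m \<in> {n. n \<ge> n\<^sub>0 \<and> P n}"
      using True False by (rule Max_in)
    have le: "n \<le> ?m" if "n \<ge> n\<^sub>0" "P n" for n
      using True that by (intro Max_ge) auto
    have "max_from n\<^sub>0 P = of_nat ?m"
      unfolding max_from_def
    proof (rule antisym)
      show "(SUP n\<in>{n. n \<ge> n\<^sub>0 \<and> P n}. of_nat n) \<le> (of_nat ?m :: ennreal)"
        using le by (intro SUP_least) auto
      show "of_nat ?m \<le> (SUP n\<in>{n. n \<ge> n\<^sub>0 \<and> P n}. of_nat n :: ennreal)"
        using m by (rule SUP_upper)
    qed
    with m le show ?thesis
      by (intro fin[of ?m]) auto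
  qed
next
  case False
  have "max_from n\<^sub>0 P = \<infinity>"
  proof (rule ccontr)
    assume "max_from n\<^sub>0 P \<noteq> \<infinity>"
    then obtain N where N: "max_from n\<^sub>0 P < of_nat N"
      using ennreal_Ex_less_of_nat by (auto simp: less_top)
    have "n < N" if "n \<ge> n\<^sub>0" "P n" for n
    proof -
      have "of_nat n \<le> max_from n\<^sub>0 P"
        unfolding max_from_def using that by (intro SUP_upper) auto
      then have "(of_nat n :: ennreal) < of_nat N"
        using N by (rule le_less_trans)
      then show ?thesis by simp
    qed
    then have "{n. n \<ge> n\<^sub>0 \<and> P n} \<subseteq> {..<N}"
      by auto
    with False show False
      using finite_subset by blast
  qed
  then show thesis
    using False by (rule inf)
qed

text \<open>Since \<open>n\<^sub>0 \<ge> 1\<close>, all counted indices lie in \<open>{1..m}\<close>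
  with \<open>m\<close> the last of them, so there are at most \<open>m\<close>. Counting the index
  0 could give \<open>m + 1\<close>.\<close>

lemma count_from_le_max_from:
  assumes "n\<^sub>0 \<ge> 1"
  shows "count_from n\<^sub>0 P \<le> max_from n\<^sub>0 P"
proof (cases rule: max_from_cases[of n\<^sub>0 P])
  case (fin m)
  have "count_from n\<^sub>0 P = (\<Sum>n. of_bool (P n) * indicator {n\<^sub>0..} n)"
    unfolding count_from_def infsum_ennreal_eq_suminf ..
  also have "\<dots> = (\<Sum>n\<in>{1..m}. of_bool (P n) * indicator {n\<^sub>0..} n)"
  proof (rule suminf_finite)
    fix n assume "n \<notin> {1..m}"
    with fin(3)[of n] assms show "of_bool (P n) * indicator {n\<^sub>0..} n = (0::ennreal)"
      by (cases "n \<ge> n\<^sub>0 \<and> P n") auto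
  qed auto
  also have "\<dots> \<le> (\<Sum>n\<in>{1..m}. 1)"
    by (intro sum_mono) (auto split: split_indicator)
  also have "\<dots> = max_from n\<^sub>0 P"
    using fin(1) by simp
  finally show ?thesis .
qed simp

section \<open>Pathwise bounds for powers of the last exceedance\<close>

lemma ennreal_powr_mono:
  assumes "x \<le> y" "0 \<le> a"
  shows "ennreal_powr x a \<le> ennreal_powr y a"
  using assms
  by (auto simp: ennreal_powr_def top_unique intro!: ennreal_leI powr_mono2 enn2real_mono)
    (simp add: less_top)

lemma ennreal_powr_of_nat: "ennreal_powr (of_nat k) a = ennreal (real k powr a)"
  by (simp add: ennreal_powr_def ennreal_of_nat_eq_real_of_nat)

lemma measurable_ennreal_powr[measurable]: "(\<lambda>x. ennreal_powr x a) \<in> borel_measurable borel"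
  unfolding ennreal_powr_def by measurable

lemma suminf_infinite_ones:
  fixes f :: "nat \<Rightarrow> ennreal"
  assumes "infinite A" "\<And>n. n \<in> A \<Longrightarrow> 1 \<le> f n"
  shows "(\<Sum>n. f n) = \<infinity>"
proof (rule ccontr)
  assume "(\<Sum>n. f n) \<noteq> \<infinity>"
  then obtain N where N: "(\<Sum>n. f n) < of_nat N"
    using ennreal_Ex_less_of_nat by (auto simp: less_top)
  obtain F where F: "F \<subseteq> A" "finite F" "card F = N"
    using infinite_arbitrarily_large[OF assms(1)] by blast
  have "of_nat N = (\<Sum>n\<in>F. 1::ennreal)"
    using F by simp
  also have "\<dots> \<le> (\<Sum>n\<in>F. f n)"
    using F assms(2) by (intro sum_mono) auto
  also have "\<dots> \<le> (\<Sum>n. f n)"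
    using F by (intro sum_le_suminf) auto
  finally show False
    using N by simp
qed

text \<open>A positive last exceedance contributes its own term, which equals the left side;
  infinitely many exceedances make the series diverge. The bound applies to arbitrary
  \<open>P\<close>, at the price of the full weight \<open>n powr a\<close>.\<close>

lemma max_from_powr_le:
  assumes "n\<^sub>0 \<ge> 1" "0 < a"
  shows "ennreal_powr (max_from n\<^sub>0 P) a \<le> (\<Sum>n. ennreal (real n powr a) * (indicator {n\<^sub>0..} n * of_bool (P n)))"
    (is "_ \<le> suminf ?f")
proof (cases rule: max_from_cases[of n\<^sub>0 P])
  case (fin m)
  show ?thesis
  proof (cases "m = 0")
    case True
    then show ?thesis using fin by (simp add: ennreal_powr_def)
  next
    case False
    then have "ennreal_powr (max_from n\<^sub>0 P) a = sum ?f {m}"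
      using fin by (simp add: ennreal_powr_of_nat)
    also have "\<dots> \<le> suminf ?f"
      by (rule sum_le_suminf) auto
    finally show ?thesis .
  qed
next
  case inf
  have "suminf ?f = \<infinity>"
    using assms by (intro suminf_infinite_ones[OF inf(2)]) (auto intro!: ge_one_powr_ge_zero)
  then show ?thesis
    by simp
qed

text \<open>Comparison of a sum with an integral: each increment of \<open>x powr (1 + q)\<close>
  over a unit interval is at most \<open>1 + q\<close> times the value of \<open>x powr q\<close> at
  the right endpoint.\<close>

lemma powr_le_sum_powr:
  assumes "0 \<le> q"
  shows "real m powr (1 + q) \<le> (1 + q) * (\<Sum>n\<in>{1..m}. real n powr q)"
proof (induction m)
  case (Suc m)
  have "real (Suc m) powr (1 + q) - real m powr (1 + q) \<le> (1 + q) * real (Suc m) powr q"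
  \<comment> \<open>The mean value theorem is applied where the left endpoint is positive, so that
    \<open>powr\<close> is differentiable there; the step from 0 to 1 is evaluated directly.\<close>
  proof (cases "m = 0")
    case False
    have "\<exists>z. real m < z \<and> z < real (Suc m) \<and> real (Suc m) powr (1 + q) - real m powr (1 + q)
        = (real (Suc m) - real m) * ((1 + q) * z powr q)"
    proof (rule MVT2)
      fix x assume "real m \<le> x"
      with False have "0 < x" by linarith
      from has_real_derivative_powr[OF this, of "1 + q"]
      show "((\<lambda>x. x powr (1 + q)) has_real_derivative (1 + q) * x powr q) (at x)"
        by simp
    qed simp
    then obtain z where z: "real m < z" "z < real (Suc m)"
      "real (Suc m) powr (1 + q) - real m powr (1 + q) = (1 + q) * z powr q" by auto
    show ?thesis
      unfolding z(3) using z assms by (intro mult_left_mono powr_mono2) auto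
  qed (use assms in auto)
  with Suc show ?case
    by (simp add: algebra_simps)
qed auto

text \<open>When exceedances are closed downwards, every index up to the last one is an exceedance,
  and the weights \<open>n powr q\<close> already add up to the order of the power
  \<open>1 + q\<close>. This saves one power of the index against
  \<open>max_from_powr_le\<close>.\<close>

lemma max_from_powr_le_decreasing:
  assumes "0 \<le> q" and dec: "\<And>m n. m \<le> n \<Longrightarrow> P n \<Longrightarrow> P m"
  shows "ennreal_powr (max_from n\<^sub>0 P) (1 + q)
    \<le> ennreal (1 + q) * (\<Sum>n. ennreal (real n powr q) * (indicator {1..} n * of_bool (P n)))"
    (is "_ \<le> _ * suminf ?f")
proof (cases rule: max_from_cases[of n\<^sub>0 P])
  case (fin m)
  show ?thesis
  proof (cases "m = 0")
    case True
    then show ?thesis using fin by (simp add: ennreal_powr_def)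
  next
    case False
    have "ennreal_powr (max_from n\<^sub>0 P) (1 + q) = ennreal (real m powr (1 + q))"
      using fin by (simp add: ennreal_powr_of_nat)
    also have "\<dots> \<le> ennreal ((1 + q) * (\<Sum>n\<in>{1..m}. real n powr q))"
      using powr_le_sum_powr[OF assms(1)] by (rule ennreal_leI)
    also have "\<dots> = ennreal (1 + q) * (\<Sum>n\<in>{1..m}. ennreal (real n powr q))"
      using assms by (simp add: ennreal_mult' sum_nonneg)
    also have "(\<Sum>n\<in>{1..m}. ennreal (real n powr q)) = sum ?f {1..m}"
    proof (intro sum.cong refl)
      \<comment> \<open>Downward closure reaches below \<open>n\<^sub>0\<close> as well, which is
        why the series starts at 1.\<close>
      fix n assume n: "n \<in> {1..m}"
      then have "P n"
        using fin(2) False dec[of n m] by simp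
      with n show "ennreal (real n powr q) = ?f n"
        by simp
    qed
    also have "ennreal (1 + q) * sum ?f {1..m} \<le> ennreal (1 + q) * suminf ?f"
      by (intro mult_left_mono sum_le_suminf) auto
    finally show ?thesis .
  qed
next
  case inf
  have "suminf ?f = \<infinity>"
  proof (rule suminf_infinite_ones)
    show "infinite {1::nat..}"
      by (rule infinite_Ici)
    fix n :: nat assume n: "n \<in> {1..}"
    obtain m where "m \<ge> n" "P m"
      using inf(2) unfolding infinite_nat_iff_unbounded_le by blast
    then have "P n"
      using dec by blast
    with n assms show "1 \<le> ?f n"
      by (auto intro!: ge_one_powr_ge_zero)
  qed
  then show ?thesis
    using assms by (simp add: ennreal_mult_top)
qed

section \<open>Moments, tail probabilities and the Borel-Cantelli lemma\<close>

lemma emeasure_le_nn_integral: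
  assumes "A \<in> sets M" "\<And>\<omega>. \<omega> \<in> A \<Longrightarrow> 1 \<le> f \<omega>"
  shows "emeasure M A \<le> (\<integral>\<^sup>+\<omega>. f \<omega> \<partial>M)"
proof -
  have "emeasure M A = (\<integral>\<^sup>+\<omega>. indicator A \<omega> \<partial>M)"
    using assms(1) by simp
  also have "\<dots> \<le> (\<integral>\<^sup>+\<omega>. f \<omega> \<partial>M)"
    using assms(2) by (intro nn_integral_mono) (auto split: split_indicator)
  finally show ?thesis .
qed

lemma Markov_ennreal_powr:
  assumes [measurable]: "f \<in> borel_measurable M" and "0 \<le> a" "k \<ge> 1"
  shows "emeasure M {\<omega>\<in>space M. f \<omega> \<ge> of_nat k}
    \<le> ennreal (real k powr (- a)) * (\<integral>\<^sup>+\<omega>. ennreal_powr (f \<omega>) a \<partial>M)"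
proof -
  have "emeasure M {\<omega>\<in>space M. f \<omega> \<ge> of_nat k}
      \<le> (\<integral>\<^sup>+\<omega>. ennreal (real k powr (- a)) * ennreal_powr (f \<omega>) a \<partial>M)"
  proof (rule emeasure_le_nn_integral)
    fix \<omega> assume "\<omega> \<in> {\<omega>\<in>space M. f \<omega> \<ge> of_nat k}"
    then have "ennreal (real k powr (- a)) * ennreal_powr (of_nat k) a
        \<le> ennreal (real k powr (- a)) * ennreal_powr (f \<omega>) a"
      using assms by (intro mult_left_mono ennreal_powr_mono) auto
    moreover have "ennreal (real k powr (- a)) * ennreal_powr (of_nat k) a = 1"
      using assms by (simp add: ennreal_powr_of_nat flip: ennreal_mult powr_add)
    ultimately show "1 \<le> ennreal (real k powr (- a)) * ennreal_powr (f \<omega>) a"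
      by simp
  qed measurable
  also have "\<dots> = ennreal (real k powr (- a)) * (\<integral>\<^sup>+\<omega>. ennreal_powr (f \<omega>) a \<partial>M)"
    by (rule nn_integral_cmult) measurable
  finally show ?thesis .
qed

text \<open>Termwise integration turns the pathwise series into weighted sums of exceedance
  probabilities.\<close>

lemma nn_integral_weighted_counts:
  assumes [measurable]: "\<And>n. Measurable.pred M (P n)"
  shows "(\<integral>\<^sup>+\<omega>. (\<Sum>n. c n * of_bool (P n \<omega>)) \<partial>M) = (\<Sum>n. c n * emeasure M {\<omega>\<in>space M. P n \<omega>})"
proof -
  have "(\<integral>\<^sup>+\<omega>. of_bool (P n \<omega>) \<partial>M) = emeasure M {\<omega>\<in>space M. P n \<omega>}" for n
  proof -
    have "(\<integral>\<^sup>+\<omega>. of_bool (P n \<omega>) \<partial>M) = (\<integral>\<^sup>+\<omega>. indicator {\<omega>\<in>space M. P n \<omega>} \<omega> \<partial>M)"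
      by (intro nn_integral_cong) (auto split: split_indicator)
    then show ?thesis by simp
  qed
  then show ?thesis
    by (simp add: nn_integral_suminf nn_integral_cmult)
qed

lemma measurable_max_from:
  assumes [measurable]: "\<And>n. Measurable.pred M (P n)"
  shows "(\<lambda>\<omega>. max_from n\<^sub>0 (\<lambda>n. P n \<omega>)) \<in> borel_measurable M"
  unfolding max_from_eq_SUP by measurable

lemma max_from_moment_le:
  assumes P: "\<And>n. Measurable.pred M (P n)" and "n\<^sub>0 \<ge> 1" "0 < a"
  shows "(\<integral>\<^sup>+\<omega>. ennreal_powr (max_from n\<^sub>0 (\<lambda>n. P n \<omega>)) a \<partial>M)
    \<le> (\<Sum>n. ennreal (real n powr a) * emeasure M {\<omega>\<in>space M. P n \<omega>})"
proof -
  have "(\<integral>\<^sup>+\<omega>. ennreal_powr (max_from n\<^sub>0 (\<lambda>n. P n \<omega>)) a \<partial>M)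
      \<le> (\<integral>\<^sup>+\<omega>. (\<Sum>n. ennreal (real n powr a) * of_bool (P n \<omega>)) \<partial>M)"
    using assms
    by (intro nn_integral_mono order_trans[OF max_from_powr_le] suminf_le mult_left_mono)
      (auto split: split_indicator)
  then show ?thesis
    unfolding nn_integral_weighted_counts[OF P] .
qed

lemma max_from_moment_le_decreasing:
  assumes P: "\<And>n. Measurable.pred M (P n)" and "0 \<le> q"
    and dec: "\<And>m n \<omega>. m \<le> n \<Longrightarrow> P n \<omega> \<Longrightarrow> P m \<omega>"
  shows "(\<integral>\<^sup>+\<omega>. ennreal_powr (max_from n\<^sub>0 (\<lambda>n. P n \<omega>)) (1 + q) \<partial>M)
    \<le> ennreal (1 + q) * (\<Sum>n. ennreal (real n powr q) * indicator {1..} n * emeasure M {\<omega>\<in>space M. P n \<omega>})"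
proof -
  note [measurable] = P
  have "(\<integral>\<^sup>+\<omega>. ennreal_powr (max_from n\<^sub>0 (\<lambda>n. P n \<omega>)) (1 + q) \<partial>M)
      \<le> (\<integral>\<^sup>+\<omega>. ennreal (1 + q) * (\<Sum>n. ennreal (real n powr q) * indicator {1..} n * of_bool (P n \<omega>)) \<partial>M)"
    unfolding mult.assoc
    by (intro nn_integral_mono max_from_powr_le_decreasing[OF assms(2)]) (rule dec)
  also have "\<dots> = ennreal (1 + q) * (\<integral>\<^sup>+\<omega>. (\<Sum>n. ennreal (real n powr q) * indicator {1..} n * of_bool (P n \<omega>)) \<partial>M)"
    by (rule nn_integral_cmult) measurable
  finally show ?thesis
    unfolding nn_integral_weighted_counts[OF P] .
qed

text \<open>Markov's inequality applied to a moment bound that already has the final shape, so that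
  the constant \<open>c\<close> and the zeta value \<open>z\<close> carry over unchanged.\<close>

lemma emeasure_max_from_ge_le:
  assumes P: "\<And>n. Measurable.pred M (P n)" and "0 \<le> a" "k \<ge> 1" "0 \<le> c"
    and le: "(\<integral>\<^sup>+\<omega>. ennreal_powr (max_from n\<^sub>0 (\<lambda>n. P n \<omega>)) a \<partial>M) \<le> ennreal c * z"
  shows "emeasure M {\<omega>\<in>space M. max_from n\<^sub>0 (\<lambda>n. P n \<omega>) \<ge> of_nat k} \<le> ennreal (real k powr (- a) * c) * z"
proof -
  have "emeasure M {\<omega>\<in>space M. max_from n\<^sub>0 (\<lambda>n. P n \<omega>) \<ge> of_nat k}
      \<le> ennreal (real k powr (- a)) * (\<integral>\<^sup>+\<omega>. ennreal_powr (max_from n\<^sub>0 (\<lambda>n. P n \<omega>)) a \<partial>M)"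
    by (rule Markov_ennreal_powr[OF measurable_max_from[OF P] assms(2,3)])
  also have "\<dots> \<le> ennreal (real k powr (- a)) * (ennreal c * z)"
    using le by (rule mult_left_mono) simp
  also have "\<dots> = ennreal (real k powr (- a) * c) * z"
    using \<open>0 \<le> c\<close> by (simp add: ennreal_mult mult.assoc)
  finally show ?thesis .
qed

lemma emeasure_count_from_ge_le:
  assumes P: "\<And>n. Measurable.pred M (P n)" and "n\<^sub>0 \<ge> 1"
  shows "emeasure M {\<omega>\<in>space M. count_from n\<^sub>0 (\<lambda>n. P n \<omega>) \<ge> of_nat k}
    \<le> emeasure M {\<omega>\<in>space M. max_from n\<^sub>0 (\<lambda>n. P n \<omega>) \<ge> of_nat k}"
proof (rule emeasure_mono)
  \<comment> \<open>Monotonicity asks for measurability of the larger event only; the count is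
    compared with the maximum pathwise.\<close>
  note [measurable] = measurable_max_from[OF P]
  show "{\<omega>\<in>space M. max_from n\<^sub>0 (\<lambda>n. P n \<omega>) \<ge> of_nat k} \<in> sets M"
    by measurable
  show "{\<omega>\<in>space M. count_from n\<^sub>0 (\<lambda>n. P n \<omega>) \<ge> of_nat k}
      \<subseteq> {\<omega>\<in>space M. max_from n\<^sub>0 (\<lambda>n. P n \<omega>) \<ge> of_nat k}"
    using order_trans[OF _ count_from_le_max_from[OF assms(2)]] by blast
qed

lemma count_from_moment_le:
  assumes "n\<^sub>0 \<ge> 1" "0 \<le> a"
  shows "(\<integral>\<^sup>+\<omega>. ennreal_powr (count_from n\<^sub>0 (\<lambda>n. P n \<omega>)) a \<partial>M)
    \<le> (\<integral>\<^sup>+\<omega>. ennreal_powr (max_from n\<^sub>0 (\<lambda>n. P n \<omega>)) a \<partial>M)"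
  using assms by (intro nn_integral_mono ennreal_powr_mono count_from_le_max_from)

lemma (in finite_measure) Borel_Cantelli_suminf:
  assumes P: "\<And>n. Measurable.pred M (P n)"
    and fin: "(\<Sum>n. indicator {1..} n * emeasure M {\<omega>\<in>space M. P n \<omega>}) < \<infinity>"
  shows "AE \<omega> in M. \<forall>\<^sub>F n in sequentially. \<not> P n \<omega>"
proof -
  note [measurable] = P
  \<comment> \<open>The series does not control the event at index 0, so that event is replaced by
    the empty set; an eventual statement is unaffected.\<close>
  let ?A = "\<lambda>n::nat. if n = 0 then {} else {\<omega>\<in>space M. P n \<omega>}"
  have "(\<Sum>n. ennreal (measure M (?A n))) = (\<Sum>n. indicator {1..} n * emeasure M {\<omega>\<in>space M. P n \<omega>})"
    by (intro suminf_cong) (auto simp: emeasure_eq_measure split: split_indicator)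
  with fin have "summable (\<lambda>n. measure M (?A n))"
    by (intro summable_suminf_not_top) auto
  then have "AE \<omega> in M. \<forall>\<^sub>F n in sequentially. \<omega> \<in> space M - ?A n"
    by (intro borel_cantelli_AE1) (auto simp: emeasure_eq_measure)
  then show ?thesis
    using AE_space
  proof eventually_elim
    case (elim \<omega>)
    from elim(1) eventually_gt_at_top[of 0] show ?case
      by eventually_elim (use elim(2) in auto)
  qed
qed

section \<open>Tail bounds for truncated sums\<close>

text \<open>Only an upper bound on \<open>u\<close> enters, so \<open>u\<close> may be arbitrarily
  negative. From \<open>exp u * (1 - u) \<le> 1\<close> follows
  \<open>exp u - 1 - u \<le> u * (exp u - 1)\<close>, and the last factor has the sign of
  \<open>u\<close> and modulus at most \<open>\<bar>u\<bar> * exp b\<close>.\<close>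

lemma exp_le_quadratic:
  fixes u b :: real
  assumes "u \<le> b" "0 \<le> b"
  shows "exp u \<le> 1 + u + u\<^sup>2 * exp b"
proof -
  have 1: "exp u * (1 - u) \<le> 1"
  proof -
    have "1 - u \<le> exp (- u)"
      using exp_ge_add_one_self[of "-u"] by simp
    then have "exp u * (1 - u) \<le> exp u * exp (- u)"
      by (rule mult_left_mono) simp
    then show ?thesis
      by (simp add: exp_minus)
  qed
  have 2: "u * (exp u - 1) \<le> u\<^sup>2 * exp b"
  proof (cases "u \<ge> 0")
    case True
    have "exp u - 1 \<le> u * exp u"
      using 1 by (simp add: algebra_simps)
    also have "\<dots> \<le> u * exp b"
      using True assms by (intro mult_left_mono) auto
    finally show ?thesis
      using mult_left_mono[OF _ True, of "exp u - 1" "u * exp b"] by (simp add: power2_eq_square mult.assoc)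
  next
    case False
    have "(-u) * (1 - exp u) \<le> (-u) * (-u * exp b)"
    proof (intro mult_left_mono)
      have "1 - exp u \<le> -u"
        using exp_ge_add_one_self[of u] by linarith
      also have "\<dots> \<le> -u * exp b"
        using False assms by simp
      finally show "1 - exp u \<le> - u * exp b" .
    qed (use False in auto)
    then show ?thesis
      by (simp add: algebra_simps power2_eq_square)
  qed
  from 1 2 show ?thesis
    by (simp add: algebra_simps)
qed

lemma emeasure_abs_gt_le_moment:
  fixes Z :: "'a \<Rightarrow> real"
  assumes [measurable]: "Z \<in> borel_measurable M"
    and p: "integrable M (\<lambda>\<omega>. \<bar>Z \<omega>\<bar> powr p)" "0 \<le> p" and "0 < t"
  shows "emeasure M {\<omega>\<in>space M. \<bar>Z \<omega>\<bar> > t} \<le> ennreal ((\<integral>\<omega>. \<bar>Z \<omega>\<bar> powr p \<partial>M) * t powr (- p))"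
proof -
  have "emeasure M {\<omega>\<in>space M. \<bar>Z \<omega>\<bar> > t} \<le> (\<integral>\<^sup>+\<omega>. ennreal (\<bar>Z \<omega>\<bar> powr p * t powr (- p)) \<partial>M)"
  proof (rule emeasure_le_nn_integral)
    fix \<omega> assume "\<omega> \<in> {\<omega>\<in>space M. \<bar>Z \<omega>\<bar> > t}"
    then have "t powr p * t powr (- p) \<le> \<bar>Z \<omega>\<bar> powr p * t powr (- p)"
      using assms by (intro mult_right_mono powr_mono2) auto
    then show "1 \<le> ennreal (\<bar>Z \<omega>\<bar> powr p * t powr (- p))"
      using assms by (simp flip: powr_add)
  qed measurable
  also have "\<dots> = ennreal (\<integral>\<omega>. \<bar>Z \<omega>\<bar> powr p * t powr (- p) \<partial>M)"
    using p by (intro nn_integral_eq_integral) auto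
  finally show ?thesis
    by simp
qed

text \<open>The exponent is the Chernoff exponent for the threshold \<open>\<delta> k^g\<close> and
  the truncation level \<open>d k^g\<close>. The parameter \<open>h\<close> may vary with
  \<open>k\<close>, whereas \<open>d\<close> and \<open>C\<close> may not.\<close>

lemma Chernoff_parameter:
  fixes \<delta> g c v :: real
  assumes "0 < \<delta>" "1 / 2 < g" "0 < c" "0 \<le> v"
  obtains d C where "0 < d" "0 \<le> C"
    "\<And>k::nat. k \<ge> 1 \<Longrightarrow> \<exists>h\<ge>0. exp (real k * (h\<^sup>2 * v * exp (h * (d * real k powr g))) - h * (\<delta> * real k powr g))
      \<le> C * real k powr (- c)"
proof -
  define s where "s = (2 * g - 1) / 2"
  \<comment> \<open>With \<open>h = c ln k / (\<delta> k\<^sup>g)\<close> this \<open>d\<close> gives \<open>exp (h d k\<^sup>g) = k\<^sup>s\<close>, so the quadratic term is of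
    order \<open>(ln k)\<^sup>2\<close> times the power of \<open>k\<close> with exponent \<open>1 - 2 g + s = - s\<close>.\<close>
  define d where "d = \<delta> * s / c"
  \<comment> \<open>\<open>B\<close> bounds the quadratic term for all \<open>k\<close> at once: its
    last factor bounds \<open>(ln k)^2 k^(-s)\<close>, by
    \<open>ln k \<le> (2 / s) k^(s / 2)\<close>.\<close>
  define B where "B = v * c\<^sup>2 / \<delta>\<^sup>2 * (2 / s)\<^sup>2"
  have s: "0 < s"
    using assms by (simp add: s_def)
  have "\<exists>h\<ge>0. exp (real k * (h\<^sup>2 * v * exp (h * (d * real k powr g))) - h * (\<delta> * real k powr g))
      \<le> exp B * real k powr (- c)" if k: "k \<ge> 1" for k :: nat
  proof (intro exI conjI)
    let ?L = "ln (real k)"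
    let ?h = "c * ?L / (\<delta> * real k powr g)"
    \<comment> \<open>\<open>h = 0\<close> does occur, namely at \<open>k = 1\<close>, where the
      logarithm vanishes.\<close>
    show "0 \<le> ?h"
      using assms k by simp
    have 1: "?h * (d * real k powr g) = s * ?L"
      using assms k by (simp add: d_def field_simps)
    have 2: "?h * (\<delta> * real k powr g) = c * ?L"
      using assms k by simp
    have exps: "exp (s * ?L) = real k powr s" "exp (c * ?L) = real k powr c"
      using k by (simp_all add: powr_def)
    have "real k * (?h\<^sup>2 * v * exp (s * ?L)) = v * c\<^sup>2 / \<delta>\<^sup>2 * (?L\<^sup>2 * (real k * real k powr s / (real k powr g)\<^sup>2))"
      using assms k unfolding exps by (simp add: field_simps power2_eq_square)
    also have "real k * real k powr s / (real k powr g)\<^sup>2 = real k powr (- s)"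
    proof -
      have "real k * real k powr s / (real k powr g)\<^sup>2 = real k powr 1 * real k powr s / real k powr (g + g)"
        using k by (simp only: power2_eq_square powr_add) simp
      also have "\<dots> = real k powr (1 + s - (g + g))"
        by (simp only: powr_add powr_diff)
      also have "1 + s - (g + g) = - s"
        by (simp add: s_def field_simps)
      finally show ?thesis .
    qed
    also have "?L\<^sup>2 * real k powr (- s) \<le> (2 / s)\<^sup>2"
    proof -
      have "?L \<le> real k powr (s / 2) / (s / 2)"
        using s k by (intro ln_powr_bound) auto
      then have "?L\<^sup>2 \<le> (real k powr (s / 2) / (s / 2))\<^sup>2"
        using k by (intro power_mono) auto
      also have "\<dots> = (2 / s)\<^sup>2 * real k powr s"
        by (simp add: power2_eq_square flip: powr_add)
      finally have "?L\<^sup>2 * real k powr (- s) \<le> (2 / s)\<^sup>2 * real k powr s * real k powr (- s)"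
        by (rule mult_right_mono) simp
      also have "\<dots> = (2 / s)\<^sup>2"
        using k by (simp add: mult.assoc flip: powr_add)
      finally show ?thesis .
    qed
    finally have 3: "real k * (?h\<^sup>2 * v * exp (s * ?L)) \<le> B"
      using assms by (simp add: B_def mult_left_mono divide_right_mono)
    have "exp (real k * (?h\<^sup>2 * v * exp (s * ?L)) - c * ?L) \<le> exp (B - c * ?L)"
      using 3 by simp
    also have "\<dots> = exp B * real k powr (- c)"
      unfolding exp_diff exps by (simp add: powr_minus divide_inverse)
    finally show "exp (real k * (?h\<^sup>2 * v * exp (?h * (d * real k powr g))) - ?h * (\<delta> * real k powr g))
      \<le> exp B * real k powr (- c)"
      unfolding 1 2 .
  qed
  moreover have "0 < d"
    using assms s by (simp add: d_def)
  ultimately show thesis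
    using that[of d "exp B"] by simp
qed

section \<open>Exponential bounds under independence\<close>

context prob_space
begin

text \<open>Truncating from above at \<open>y \<ge> 0\<close> increases neither the variable nor its
  square. The quadratic majorant can thus be written in \<open>Z\<close> itself, whose linear term
  integrates to 0.\<close>

lemma truncated_mgf_le:
  fixes Z :: "'a \<Rightarrow> real"
  assumes Z: "integrable M Z" "expectation Z = 0" "integrable M (\<lambda>\<omega>. (Z \<omega>)\<^sup>2)"
    and h: "0 \<le> h" and y: "0 \<le> y"
  shows "(\<integral>\<^sup>+\<omega>. ennreal (exp (h * min (Z \<omega>) y)) \<partial>M)
    \<le> ennreal (exp (h\<^sup>2 * expectation (\<lambda>\<omega>. (Z \<omega>)\<^sup>2) * exp (h * y)))"
proof -
  let ?R = "\<lambda>\<omega>. 1 + h * Z \<omega> + h\<^sup>2 * exp (h * y) * (Z \<omega>)\<^sup>2"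
  have le: "exp (h * min (Z \<omega>) y) \<le> ?R \<omega>" for \<omega>
  proof -
    let ?m = "min (Z \<omega>) y"
    have "exp (h * ?m) \<le> 1 + h * ?m + (h * ?m)\<^sup>2 * exp (h * y)"
      using h y by (intro exp_le_quadratic mult_left_mono) auto
    moreover have "h * ?m \<le> h * Z \<omega>"
      using h by (intro mult_left_mono) auto
    moreover have "(h * ?m)\<^sup>2 * exp (h * y) \<le> h\<^sup>2 * exp (h * y) * (Z \<omega>)\<^sup>2"
    proof -
      have "?m\<^sup>2 \<le> (Z \<omega>)\<^sup>2"
        using y by (intro iffD1[OF abs_le_square_iff]) (auto simp: min_def)
      then show ?thesis
        by (simp add: power_mult_distrib mult_left_mono mult.assoc mult.commute)
    qed
    ultimately show ?thesis by linarith
  qed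
  \<comment> \<open>Nonnegativity holds because the majorant lies above an exponential; it permits
    the passage to the ordinary expectation.\<close>
  have nn: "0 \<le> ?R \<omega>" for \<omega>
    by (rule order_trans[OF _ le]) simp
  have "(\<integral>\<^sup>+\<omega>. ennreal (exp (h * min (Z \<omega>) y)) \<partial>M) \<le> (\<integral>\<^sup>+\<omega>. ennreal (?R \<omega>) \<partial>M)"
    using le by (intro nn_integral_mono ennreal_leI)
  also have "\<dots> = ennreal (expectation ?R)"
    using Z nn by (intro nn_integral_eq_integral) auto
  also have "expectation ?R = 1 + h\<^sup>2 * expectation (\<lambda>\<omega>. (Z \<omega>)\<^sup>2) * exp (h * y)"
    using Z by (simp add: prob_space)
  also have "\<dots> \<le> exp (h\<^sup>2 * expectation (\<lambda>\<omega>. (Z \<omega>)\<^sup>2) * exp (h * y))"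
    by (rule exp_ge_add_one_self)
  finally show ?thesis
    by (simp add: ennreal_leI)
qed

text \<open>On the event no truncation is active, so the sum equals that of the variables
  \<open>min (Z i \<omega>) y\<close>, whose exponential factorizes in expectation by
  independence.\<close>

lemma Chernoff_truncated:
  fixes Z :: "'i \<Rightarrow> 'a \<Rightarrow> real"
  assumes I: "finite I" "indep_vars (\<lambda>_. borel) Z I"
    and Z: "\<And>i. i \<in> I \<Longrightarrow> integrable M (Z i)" "\<And>i. i \<in> I \<Longrightarrow> expectation (Z i) = 0"
      "\<And>i. i \<in> I \<Longrightarrow> integrable M (\<lambda>\<omega>. (Z i \<omega>)\<^sup>2)"
      "\<And>i. i \<in> I \<Longrightarrow> expectation (\<lambda>\<omega>. (Z i \<omega>)\<^sup>2) = v"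
    and h: "0 \<le> h" and y: "0 \<le> y"
  shows "emeasure M {\<omega>\<in>space M. x < (\<Sum>i\<in>I. Z i \<omega>) \<and> (\<forall>i\<in>I. Z i \<omega> \<le> y)}
    \<le> ennreal (exp (real (card I) * (h\<^sup>2 * v * exp (h * y)) - h * x))"
proof -
  have [measurable]: "Z i \<in> borel_measurable M" if "i \<in> I" for i
    using Z(1)[OF that] by simp
  let ?e = "\<lambda>i \<omega>. ennreal (exp (h * min (Z i \<omega>) y))"
  have "emeasure M {\<omega>\<in>space M. x < (\<Sum>i\<in>I. Z i \<omega>) \<and> (\<forall>i\<in>I. Z i \<omega> \<le> y)}
      \<le> (\<integral>\<^sup>+\<omega>. ennreal (exp (- h * x)) * (\<Prod>i\<in>I. ?e i \<omega>) \<partial>M)"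
  proof (rule emeasure_le_nn_integral)
    show "{\<omega>\<in>space M. x < (\<Sum>i\<in>I. Z i \<omega>) \<and> (\<forall>i\<in>I. Z i \<omega> \<le> y)} \<in> events"
      using I(1) by measurable
    fix \<omega> assume \<omega>: "\<omega> \<in> {\<omega>\<in>space M. x < (\<Sum>i\<in>I. Z i \<omega>) \<and> (\<forall>i\<in>I. Z i \<omega> \<le> y)}"
    have "ennreal (exp (- h * x)) * (\<Prod>i\<in>I. ?e i \<omega>)
        = ennreal (exp (- h * x) * exp (\<Sum>i\<in>I. h * min (Z i \<omega>) y))"
      using I(1) by (simp add: prod_ennreal exp_sum ennreal_mult' prod_nonneg)
    also have "(\<Sum>i\<in>I. h * min (Z i \<omega>) y) = h * (\<Sum>i\<in>I. Z i \<omega>)"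
      using \<omega> by (auto simp: sum_distrib_left min_def intro!: sum.cong)
    finally have "ennreal (exp (- h * x)) * (\<Prod>i\<in>I. ?e i \<omega>) = ennreal (exp (h * ((\<Sum>i\<in>I. Z i \<omega>) - x)))"
      by (simp add: algebra_simps flip: exp_add)
    also have "\<dots> \<ge> 1"
      using \<omega> h by simp
    finally show "1 \<le> ennreal (exp (- h * x)) * (\<Prod>i\<in>I. ?e i \<omega>)" .
  qed
  also have "\<dots> = ennreal (exp (- h * x)) * (\<integral>\<^sup>+\<omega>. (\<Prod>i\<in>I. ?e i \<omega>) \<partial>M)"
    by (rule nn_integral_cmult) measurable
  also have "(\<integral>\<^sup>+\<omega>. (\<Prod>i\<in>I. ?e i \<omega>) \<partial>M) = (\<Prod>i\<in>I. \<integral>\<^sup>+\<omega>. ?e i \<omega> \<partial>M)"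
    by (intro indep_vars_nn_integral I indep_vars_compose2[OF I(2)]) auto
  also have "\<dots> \<le> (\<Prod>i\<in>I. ennreal (exp (h\<^sup>2 * v * exp (h * y))))"
    using truncated_mgf_le[OF Z(1-3) h y] Z(4) by (intro prod_mono_ennreal) auto
  also have "\<dots> = ennreal (exp (real (card I) * (h\<^sup>2 * v * exp (h * y))))"
    by (simp add: ennreal_power exp_of_nat_mult)
  also have "ennreal (exp (- h * x)) * \<dots> = ennreal (exp (real (card I) * (h\<^sup>2 * v * exp (h * y)) - h * x))"
    by (simp add: exp_diff exp_minus divide_inverse mult.commute flip: ennreal_mult)
  finally show ?thesis
    by (simp add: mult_left_mono)
qed

text \<open>Any polynomial rate \<open>c\<close> is attainable, since \<open>d\<close> is chosen
  after it. The one-sided bound is applied to \<open>Z\<close> and to its negative, which doubles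
  the constant.\<close>

lemma truncated_sum_tail:
  fixes Z :: "nat \<Rightarrow> 'a \<Rightarrow> real"
  assumes indep: "indep_vars (\<lambda>_. borel) Z {1..}"
    and Z: "\<And>i. i \<ge> 1 \<Longrightarrow> integrable M (Z i)" "\<And>i. i \<ge> 1 \<Longrightarrow> expectation (Z i) = 0"
      "\<And>i. i \<ge> 1 \<Longrightarrow> integrable M (\<lambda>\<omega>. (Z i \<omega>)\<^sup>2)"
      "\<And>i. i \<ge> 1 \<Longrightarrow> expectation (\<lambda>\<omega>. (Z i \<omega>)\<^sup>2) = v"
    and "0 < \<delta>" "1 / 2 < g" "0 < c"
  obtains d C where "0 < d" "0 \<le> C"
    "\<And>k. k \<ge> 1 \<Longrightarrow> emeasure M {\<omega>\<in>space M. \<delta> * real k powr g < \<bar>\<Sum>i\<in>{1..k}. Z i \<omega>\<bar> \<and>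
        (\<forall>i\<in>{1..k}. \<bar>Z i \<omega>\<bar> \<le> d * real k powr g)} \<le> ennreal (C * real k powr (- c))"
proof -
  have "0 \<le> v"
    using Z(4)[of 1] by (metis Bochner_Integration.integral_nonneg order_refl zero_le_power2)
  then obtain d C where d: "0 < d" "0 \<le> C" and dC:
    "\<And>k::nat. k \<ge> 1 \<Longrightarrow> \<exists>h\<ge>0. exp (real k * (h\<^sup>2 * v * exp (h * (d * real k powr g))) - h * (\<delta> * real k powr g))
      \<le> C * real k powr (- c)"
    using Chernoff_parameter[of \<delta> g c v] assms by metis
  have [measurable]: "Z i \<in> borel_measurable M" if "i \<ge> 1" for i
    using Z(1)[OF that] by simp
  have one: "emeasure M {\<omega>\<in>space M. \<delta> * real k powr g < (\<Sum>i\<in>{1..k}. W i \<omega>) \<and>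
        (\<forall>i\<in>{1..k}. W i \<omega> \<le> d * real k powr g)} \<le> ennreal (C * real k powr (- c))"
    if k: "k \<ge> 1" and W: "W = Z \<or> W = (\<lambda>i \<omega>. - Z i \<omega>)" for k W
  proof -
    obtain h where h: "h \<ge> 0"
      "exp (real k * (h\<^sup>2 * v * exp (h * (d * real k powr g))) - h * (\<delta> * real k powr g)) \<le> C * real k powr (- c)"
      using dC[OF k] by blast
    have "indep_vars (\<lambda>_. borel) Z {1..k}"
      using indep by (rule indep_vars_subset) auto
    then have "indep_vars (\<lambda>_. borel) W {1..k}"
      using W indep_vars_compose2[of "\<lambda>_. borel" Z "{1..k}" "\<lambda>_ x. - x" "\<lambda>_. borel"] by auto
    then have "emeasure M {\<omega>\<in>space M. \<delta> * real k powr g < (\<Sum>i\<in>{1..k}. W i \<omega>) \<and>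
        (\<forall>i\<in>{1..k}. W i \<omega> \<le> d * real k powr g)} \<le>
        ennreal (exp (real (card {1..k}) * (h\<^sup>2 * v * exp (h * (d * real k powr g))) - h * (\<delta> * real k powr g)))"
      using W Z h d by (intro Chernoff_truncated) auto
    also have "\<dots> \<le> ennreal (C * real k powr (- c))"
      using h(2) by (intro ennreal_leI) simp
    finally show ?thesis .
  qed
  show thesis
  proof (rule that[OF d(1)])
    show "0 \<le> 2 * C"
      using d by simp
    fix k :: nat assume k: "k \<ge> 1"
    let ?A = "\<lambda>W. {\<omega>\<in>space M. \<delta> * real k powr g < (\<Sum>i\<in>{1..k}. W i \<omega>) \<and>
        (\<forall>i\<in>{1..k}. W i \<omega> \<le> d * real k powr g)}"
    let ?N = "\<lambda>i \<omega>. - Z i \<omega>"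
    have "emeasure M {\<omega>\<in>space M. \<delta> * real k powr g < \<bar>\<Sum>i\<in>{1..k}. Z i \<omega>\<bar> \<and>
        (\<forall>i\<in>{1..k}. \<bar>Z i \<omega>\<bar> \<le> d * real k powr g)} \<le> emeasure M (?A Z \<union> ?A ?N)"
    proof (rule emeasure_mono)
      show "{\<omega>\<in>space M. \<delta> * real k powr g < \<bar>\<Sum>i\<in>{1..k}. Z i \<omega>\<bar> \<and>
        (\<forall>i\<in>{1..k}. \<bar>Z i \<omega>\<bar> \<le> d * real k powr g)} \<subseteq> ?A Z \<union> ?A ?N"
        unfolding sum_negf abs_le_iff by (auto simp: abs_if split: if_split_asm)
    qed measurable
    also have "\<dots> \<le> emeasure M (?A Z) + emeasure M (?A ?N)"
      by (intro emeasure_subadditive) measurable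
    also have "\<dots> \<le> ennreal (C * real k powr (- c)) + ennreal (C * real k powr (- c))"
      using one[OF k] by (intro add_mono) auto
    also have "\<dots> = ennreal (2 * C * real k powr (- c))"
      using d by (simp flip: ennreal_plus)
    finally show "emeasure M {\<omega>\<in>space M. \<delta> * real k powr g < \<bar>\<Sum>i\<in>{1..k}. Z i \<omega>\<bar> \<and>
        (\<forall>i\<in>{1..k}. \<bar>Z i \<omega>\<bar> \<le> d * real k powr g)} \<le> ennreal (2 * C * real k powr (- c))" .
  qed
qed

end

section \<open>Random walks with a finite moment\<close>

text \<open>Multiplying by \<open>n\<close> brings part (a) to the scale
  \<open>n powr (\<alpha> / p)\<close> on which part (b) is stated; \<open>n \<ge> 1\<close>
  excludes division by 0.\<close>

lemma tolerance_less_iff: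
  assumes "n \<ge> 1"
  shows "tolerance \<alpha> \<eta> p n < \<bar>x\<bar> / real n \<longleftrightarrow> \<eta> * real n powr (\<alpha> / p) < \<bar>x\<bar>"
  using assms by (simp add: tolerance_def powr_diff field_simps)

text \<open>A supremum lies strictly above \<open>\<epsilon>\<close> exactly when one of its terms
  does, attained or not, so the event becomes a countable union.\<close>

lemma less_tail_max_iff:
  assumes "0 \<le> \<epsilon>" "n \<ge> 1"
  shows "ennreal \<epsilon> < tail_max X \<alpha> p n \<omega> \<longleftrightarrow> (\<exists>k\<ge>n. \<epsilon> * real k powr (\<alpha> / p) < \<bar>X k \<omega>\<bar>)"
proof -
  have "ennreal \<epsilon> < tail_max X \<alpha> p n \<omega> \<longleftrightarrow> (\<exists>k\<ge>n. \<epsilon> < \<bar>X k \<omega>\<bar> / real k powr (\<alpha> / p))"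
    using assms(1) by (auto simp: tail_max_def less_SUP_iff ennreal_less_iff)
  also have "\<dots> \<longleftrightarrow> (\<exists>k\<ge>n. \<epsilon> * real k powr (\<alpha> / p) < \<bar>X k \<omega>\<bar>)"
    using assms(2) by (intro ex_cong) (auto simp: less_divide_eq)
  finally show ?thesis .
qed

lemma tail_max_antimono: "m \<le> n \<Longrightarrow> tail_max X \<alpha> p n \<omega> \<le> tail_max X \<alpha> p m \<omega>"
  unfolding tail_max_def by (rule SUP_subset_mono) auto

section \<open>Tails of the increments, of the walk and of its normalized supremum\<close>

locale iid_walk = prob_space M for M :: "'a measure" +
  fixes \<Delta> :: "nat \<Rightarrow> 'a \<Rightarrow> real" and X :: "nat \<Rightarrow> 'a \<Rightarrow> real" and p :: real
  assumes indep: "indep_vars (\<lambda>_. borel) \<Delta> {1..}"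
    and ident: "\<And>n. n \<ge> 1 \<Longrightarrow> distr M borel (\<Delta> n) = distr M borel (\<Delta> 1)"
    and centered: "\<And>n. n \<ge> 1 \<Longrightarrow> integrable M (\<Delta> n) \<and> expectation (\<Delta> n) = 0"
    and X: "X = partial_sum \<Delta>"
    and p: "p \<ge> 2"
    and moment: "integrable M (\<lambda>\<omega>. \<bar>\<Delta> 1 \<omega>\<bar> powr p)"
begin

lemma measurable_increment: "i \<ge> 1 \<Longrightarrow> \<Delta> i \<in> borel_measurable M"
  using centered by blast

lemma measurable_walk[measurable]: "X n \<in> borel_measurable M"
  unfolding X partial_sum_def using measurable_increment by measurable

lemma
  fixes f :: "real \<Rightarrow> real"
  assumes i: "i \<ge> 1" and [measurable]: "f \<in> borel_measurable borel"
  shows integrable_increment: "integrable M (\<lambda>\<omega>. f (\<Delta> i \<omega>)) \<longleftrightarrow> integrable M (\<lambda>\<omega>. f (\<Delta> 1 \<omega>))"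
    and expectation_increment: "expectation (\<lambda>\<omega>. f (\<Delta> i \<omega>)) = expectation (\<lambda>\<omega>. f (\<Delta> 1 \<omega>))"
  using integrable_distr_eq[OF measurable_increment[OF i], of f] integral_distr[OF measurable_increment[OF i], of f]
    integrable_distr_eq[OF measurable_increment[of 1], of f] integral_distr[OF measurable_increment[of 1], of f]
    ident[OF i] by simp_all

text \<open>The variance needed in the Chernoff bound is finite because
  \<open>x^2 \<le> 1 + \<bar>x\<bar> powr p\<close>, which for \<open>\<bar>x\<bar> > 1\<close> uses
  \<open>p \<ge> 2\<close>.\<close>

lemma integrable_increment_square: "i \<ge> 1 \<Longrightarrow> integrable M (\<lambda>\<omega>. (\<Delta> i \<omega>)\<^sup>2)"
proof -
  assume "i \<ge> 1"
  have [measurable]: "\<Delta> 1 \<in> borel_measurable M"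
    by (rule measurable_increment) simp
  have "integrable M (\<lambda>\<omega>. (\<Delta> 1 \<omega>)\<^sup>2)"
  proof (rule Bochner_Integration.integrable_bound)
    show "integrable M (\<lambda>\<omega>. 1 + \<bar>\<Delta> 1 \<omega>\<bar> powr p)"
      using moment by simp
    have "x\<^sup>2 \<le> 1 + \<bar>x\<bar> powr p" for x :: real
    proof (cases "\<bar>x\<bar> \<le> 1")
      case True
      then have "x\<^sup>2 \<le> 1"
        by (simp add: abs_square_le_1)
      then show ?thesis
        by (simp add: add_increasing2)
    next
      case False
      then have "\<bar>x\<bar> powr 2 \<le> \<bar>x\<bar> powr p"
        using p by (intro powr_mono) auto
      with False show ?thesis
        by (simp add: powr_numeral)
    qed
    then show "AE \<omega> in M. norm ((\<Delta> 1 \<omega>)\<^sup>2) \<le> norm (1 + \<bar>\<Delta> 1 \<omega>\<bar> powr p)"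
      by simp
  qed measurable
  then show ?thesis
    using integrable_increment[OF \<open>i \<ge> 1\<close>, of "\<lambda>x. x\<^sup>2"] by simp
qed

text \<open>The scale \<open>k powr (\<alpha> / p)\<close> raised to the power \<open>- p\<close> is
  \<open>k powr (- \<alpha>)\<close>, so the moment of order \<open>p\<close> yields exactly this
  rate.\<close>

lemma increment_tail:
  assumes i: "i \<ge> 1" and "k \<ge> (1::nat)" "0 < d"
  shows "emeasure M {\<omega>\<in>space M. d * real k powr (\<alpha> / p) < \<bar>\<Delta> i \<omega>\<bar>}
    \<le> ennreal (expectation (\<lambda>\<omega>. \<bar>\<Delta> 1 \<omega>\<bar> powr p) * d powr (- p) * real k powr (- \<alpha>))"
proof -
  have "emeasure M {\<omega>\<in>space M. d * real k powr (\<alpha> / p) < \<bar>\<Delta> i \<omega>\<bar>}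
      \<le> ennreal (expectation (\<lambda>\<omega>. \<bar>\<Delta> i \<omega>\<bar> powr p) * (d * real k powr (\<alpha> / p)) powr (- p))"
    using assms p moment measurable_increment[OF i] integrable_increment[OF i, of "\<lambda>x. \<bar>x\<bar> powr p"]
    by (intro emeasure_abs_gt_le_moment) auto
  also have "(d * real k powr (\<alpha> / p)) powr (- p) = d powr (- p) * real k powr (- \<alpha>)"
    using assms p by (simp add: powr_mult powr_powr)
  finally show ?thesis
    using expectation_increment[OF i, of "\<lambda>x. \<bar>x\<bar> powr p"] by (simp add: mult.assoc)
qed

text \<open>The same \<open>d\<close> must serve as truncation level and as threshold for a large
  increment. It comes from the truncated sum with rate \<open>c = \<alpha>\<close>; the increment
  bound then holds for this \<open>d\<close>, and \<open>K\<close> is the larger of the two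
  constants.\<close>

lemma walk_tails:
  assumes "0 < \<delta>" "1 / 2 < \<alpha> / p"
  obtains d K where "0 < d" "0 \<le> K"
    "\<And>k. k \<ge> 1 \<Longrightarrow> emeasure M {\<omega>\<in>space M. \<delta> * real k powr (\<alpha> / p) < \<bar>X k \<omega>\<bar> \<and>
        (\<forall>i\<in>{1..k}. \<bar>\<Delta> i \<omega>\<bar> \<le> d * real k powr (\<alpha> / p))} \<le> ennreal (K * real k powr (- \<alpha>))"
    "\<And>i k. i \<ge> 1 \<Longrightarrow> k \<ge> 1 \<Longrightarrow> emeasure M {\<omega>\<in>space M. d * real k powr (\<alpha> / p) < \<bar>\<Delta> i \<omega>\<bar>}
        \<le> ennreal (K * real k powr (- \<alpha>))"
proof -
  have "0 < \<alpha> / p"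
    using assms(2) by linarith
  then have \<alpha>: "0 < \<alpha>"
    using p by (simp add: zero_less_divide_iff)
  have var: "expectation (\<lambda>\<omega>. (\<Delta> i \<omega>)\<^sup>2) = expectation (\<lambda>\<omega>. (\<Delta> 1 \<omega>)\<^sup>2)" if "i \<ge> 1" for i
    using expectation_increment[OF that, of "\<lambda>x. x\<^sup>2"] by simp
  obtain d C where d: "0 < d" "0 \<le> C" and
    C: "\<And>k. k \<ge> 1 \<Longrightarrow> emeasure M {\<omega>\<in>space M. \<delta> * real k powr (\<alpha> / p) < \<bar>\<Sum>i\<in>{1..k}. \<Delta> i \<omega>\<bar> \<and>
        (\<forall>i\<in>{1..k}. \<bar>\<Delta> i \<omega>\<bar> \<le> d * real k powr (\<alpha> / p))} \<le> ennreal (C * real k powr (- \<alpha>))"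
    using truncated_sum_tail[OF indep conjunct1[OF centered] conjunct2[OF centered]
        integrable_increment_square var assms \<alpha>] by blast
  let ?D = "expectation (\<lambda>\<omega>. \<bar>\<Delta> 1 \<omega>\<bar> powr p) * d powr (- p)"
  show thesis
  proof (rule that[of d "max C ?D"])
    show "0 < d" "0 \<le> max C ?D"
      using d by auto
    fix k :: nat assume k: "k \<ge> 1"
    have "ennreal (C * real k powr (- \<alpha>)) \<le> ennreal (max C ?D * real k powr (- \<alpha>))"
      by (intro ennreal_leI mult_right_mono) auto
    with C[OF k] show "emeasure M {\<omega>\<in>space M. \<delta> * real k powr (\<alpha> / p) < \<bar>X k \<omega>\<bar> \<and>
        (\<forall>i\<in>{1..k}. \<bar>\<Delta> i \<omega>\<bar> \<le> d * real k powr (\<alpha> / p))} \<le> ennreal (max C ?D * real k powr (- \<alpha>))"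
      unfolding X partial_sum_def by (rule order_trans)
    fix i :: nat assume i: "i \<ge> 1"
    have "ennreal (?D * real k powr (- \<alpha>)) \<le> ennreal (max C ?D * real k powr (- \<alpha>))"
      by (intro ennreal_leI mult_right_mono) auto
    with increment_tail[OF i k d(1)]
    show "emeasure M {\<omega>\<in>space M. d * real k powr (\<alpha> / p) < \<bar>\<Delta> i \<omega>\<bar>}
        \<le> ennreal (max C ?D * real k powr (- \<alpha>))"
      by (rule order_trans)
  qed
qed

text \<open>Either all increments stay below the truncation level, with probability of order
  \<open>m powr (- \<alpha>)\<close>, or one of \<open>m\<close> increments exceeds it, which costs
  a factor \<open>m\<close>.\<close>

lemma deviation_tail:
  assumes "0 < \<delta>" "1 / 2 < \<alpha> / p"
  obtains K where "0 \<le> K"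
    "\<And>m. m \<ge> 1 \<Longrightarrow> emeasure M {\<omega>\<in>space M. \<delta> * real m powr (\<alpha> / p) < \<bar>X m \<omega>\<bar>}
      \<le> ennreal (K * real m powr (1 - \<alpha>))"
proof -
  obtain d K where d: "0 < d" "0 \<le> K" and
    T: "\<And>k. k \<ge> 1 \<Longrightarrow> emeasure M {\<omega>\<in>space M. \<delta> * real k powr (\<alpha> / p) < \<bar>X k \<omega>\<bar> \<and>
        (\<forall>i\<in>{1..k}. \<bar>\<Delta> i \<omega>\<bar> \<le> d * real k powr (\<alpha> / p))} \<le> ennreal (K * real k powr (- \<alpha>))" and
    J: "\<And>i k. i \<ge> 1 \<Longrightarrow> k \<ge> 1 \<Longrightarrow> emeasure M {\<omega>\<in>space M. d * real k powr (\<alpha> / p) < \<bar>\<Delta> i \<omega>\<bar>}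
        \<le> ennreal (K * real k powr (- \<alpha>))"
    using walk_tails[OF assms] by blast
  note [measurable] = measurable_increment
  show thesis
  proof (rule that[of "2 * K"])
    fix m :: nat assume m: "m \<ge> 1"
    let ?T = "{\<omega>\<in>space M. \<delta> * real m powr (\<alpha> / p) < \<bar>X m \<omega>\<bar> \<and>
        (\<forall>i\<in>{1..m}. \<bar>\<Delta> i \<omega>\<bar> \<le> d * real m powr (\<alpha> / p))}"
    let ?J = "\<lambda>i. {\<omega>\<in>space M. d * real m powr (\<alpha> / p) < \<bar>\<Delta> i \<omega>\<bar>}"
    have [measurable]: "?T \<in> events" "\<And>i. i \<in> {1..m} \<Longrightarrow> ?J i \<in> events"
      by measurable
    have "emeasure M {\<omega>\<in>space M. \<delta> * real m powr (\<alpha> / p) < \<bar>X m \<omega>\<bar>} \<le> emeasure M (?T \<union> (\<Union>i\<in>{1..m}. ?J i))"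
      by (intro emeasure_mono) (auto simp: not_le)
    also have "\<dots> \<le> emeasure M ?T + emeasure M (\<Union>i\<in>{1..m}. ?J i)"
      by (intro emeasure_subadditive) auto
    also have "\<dots> \<le> ennreal (K * real m powr (- \<alpha>)) + (\<Sum>i\<in>{1..m}. emeasure M (?J i))"
      using T[OF m] by (intro add_mono emeasure_subadditive_finite) auto
    also have "\<dots> \<le> ennreal (K * real m powr (- \<alpha>)) + (\<Sum>i\<in>{1..m}. ennreal (K * real m powr (- \<alpha>)))"
      using J m by (intro add_left_mono sum_mono) auto
    also have "\<dots> = ennreal (K * real m powr (- \<alpha>) + real m * (K * real m powr (- \<alpha>)))"
      using d by (simp add: ennreal_plus ennreal_mult ennreal_of_nat_eq_real_of_nat)
    also have "\<dots> \<le> ennreal (2 * K * real m powr (1 - \<alpha>))"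
    proof (rule ennreal_leI)
      \<comment> \<open>As \<open>m \<ge> 1\<close>, the truncated term is absorbed by the term from
        the increments, giving the constant \<open>2 * K\<close>.\<close>
      have "1 * (K * real m powr (- \<alpha>)) \<le> real m * (K * real m powr (- \<alpha>))"
        using m d by (intro mult_right_mono) auto
      moreover have "real m powr (1 - \<alpha>) = real m * real m powr (- \<alpha>)"
        using m by (simp add: powr_diff powr_minus divide_inverse)
      ultimately show "K * real m powr (- \<alpha>) + real m * (K * real m powr (- \<alpha>)) \<le> 2 * K * real m powr (1 - \<alpha>)"
        by (simp add: algebra_simps)
    qed
    finally show "emeasure M {\<omega>\<in>space M. \<delta> * real m powr (\<alpha> / p) < \<bar>X m \<omega>\<bar>}
      \<le> ennreal (2 * K * real m powr (1 - \<alpha>))" .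
  qed (use d in simp)
qed

text \<open>Summing \<open>deviation_tail\<close> over all \<open>k \<ge> n\<close> would give the
  order \<open>n powr (2 - \<alpha>)\<close>. Instead each increment beyond \<open>n\<close> is
  charged only once, at its own level, which leaves a tail sum of \<open>m powr (- \<alpha>)\<close>
  and saves one power.\<close>

lemma tail_max_tail:
  assumes "0 < \<epsilon>" "1 / 2 < \<alpha> / p"
  obtains K where "0 \<le> K"
    "\<And>n. n \<ge> 1 \<Longrightarrow> emeasure M {\<omega>\<in>space M. ennreal \<epsilon> < tail_max X \<alpha> p n \<omega>}
      \<le> ennreal (K * real n powr (1 - \<alpha>)) + (\<Sum>m. ennreal (K * real m powr (- \<alpha>)) * indicator {n..} m)"
proof -
  obtain d K where d: "0 < d" "0 \<le> K" and
    T: "\<And>k. k \<ge> 1 \<Longrightarrow> emeasure M {\<omega>\<in>space M. \<epsilon> * real k powr (\<alpha> / p) < \<bar>X k \<omega>\<bar> \<and>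
        (\<forall>i\<in>{1..k}. \<bar>\<Delta> i \<omega>\<bar> \<le> d * real k powr (\<alpha> / p))} \<le> ennreal (K * real k powr (- \<alpha>))" and
    J: "\<And>i k. i \<ge> 1 \<Longrightarrow> k \<ge> 1 \<Longrightarrow> emeasure M {\<omega>\<in>space M. d * real k powr (\<alpha> / p) < \<bar>\<Delta> i \<omega>\<bar>}
        \<le> ennreal (K * real k powr (- \<alpha>))"
    using walk_tails[OF assms] by blast
  note [measurable] = measurable_increment
  have g: "0 \<le> \<alpha> / p"
    using assms(2) by linarith
  show thesis
  proof (rule that[of "2 * K"])
    fix n :: nat assume n: "n \<ge> 1"
    let ?T = "\<lambda>k. {\<omega>\<in>space M. \<epsilon> * real k powr (\<alpha> / p) < \<bar>X k \<omega>\<bar> \<and>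
        (\<forall>i\<in>{1..k}. \<bar>\<Delta> i \<omega>\<bar> \<le> d * real k powr (\<alpha> / p))}"
    let ?J = "\<lambda>k i. {\<omega>\<in>space M. d * real k powr (\<alpha> / p) < \<bar>\<Delta> i \<omega>\<bar>}"
    \<comment> \<open>\<open>?U k\<close> joins what is charged to time \<open>k\<close>: a
      deviation without large increments, or a large increment at that very time. Taking it empty
      below \<open>n\<close> allows a union over all naturals.\<close>
    let ?U = "\<lambda>k. if n \<le> k then ?T k \<union> ?J k k else {}"
    have J_events: "?J k i \<in> events" if "i \<ge> 1" for i k
      using that by measurable
    have T_events: "?T k \<in> events" for k
      by measurable
    have U_events: "?U k \<in> events" for k
      using J_events[of k k] T_events[of k] n by auto
    have J_union: "(\<Union>i\<in>{1..n}. ?J n i) \<in> events"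
      using J_events by (intro sets.finite_UN) auto
    have U_union: "(\<Union>k. ?U k) \<in> events"
      by (rule sets.countable_UN) (rule image_subsetI, rule U_events)
    \<comment> \<open>The truncation levels grow with \<open>k\<close>, so a large increment \<open>i > n\<close> already exceeds its own
      level \<open>d i\<^sup>g\<close>, and one \<open>i \<le> n\<close> exceeds the level of \<open>n\<close>.\<close>
    have "{\<omega>\<in>space M. ennreal \<epsilon> < tail_max X \<alpha> p n \<omega>} \<subseteq> (\<Union>i\<in>{1..n}. ?J n i) \<union> (\<Union>k. ?U k)"
    proof
      fix \<omega> assume "\<omega> \<in> {\<omega>\<in>space M. ennreal \<epsilon> < tail_max X \<alpha> p n \<omega>}"
      then obtain k where \<omega>: "\<omega> \<in> space M" and k: "k \<ge> n" "\<epsilon> * real k powr (\<alpha> / p) < \<bar>X k \<omega>\<bar>"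
        using less_tail_max_iff[of \<epsilon> n X \<alpha> p \<omega>] assms(1) n by auto
      show "\<omega> \<in> (\<Union>i\<in>{1..n}. ?J n i) \<union> (\<Union>k. ?U k)"
      proof (cases "\<forall>i\<in>{1..k}. \<bar>\<Delta> i \<omega>\<bar> \<le> d * real k powr (\<alpha> / p)")
        case True
        with \<omega> k have "\<omega> \<in> ?U k"
          by simp
        then show ?thesis by blast
      next
        case False
        then obtain i where i: "i \<in> {1..k}" "d * real k powr (\<alpha> / p) < \<bar>\<Delta> i \<omega>\<bar>"
          by (auto simp: not_le)
        have less: "d * real j powr (\<alpha> / p) < \<bar>\<Delta> i \<omega>\<bar>" if "j \<le> k" for j
        proof -
          have "d * real j powr (\<alpha> / p) \<le> d * real k powr (\<alpha> / p)"
            using that d g by (intro mult_left_mono powr_mono2) auto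
          with i show ?thesis by linarith
        qed
        show ?thesis
        proof (cases "i \<le> n")
          case True
          then have "\<omega> \<in> ?J n i" "i \<in> {1..n}"
            using \<omega> i less[of n] k by auto
          then show ?thesis by blast
        next
          case False
          then have "\<omega> \<in> ?U i"
            using \<omega> i less[of i] by simp
          then show ?thesis by blast
        qed
      qed
    qed
    then have "emeasure M {\<omega>\<in>space M. ennreal \<epsilon> < tail_max X \<alpha> p n \<omega>}
        \<le> emeasure M ((\<Union>i\<in>{1..n}. ?J n i) \<union> (\<Union>k. ?U k))"
      by (rule emeasure_mono) (rule sets.Un[OF J_union U_union])
    also have "\<dots> \<le> emeasure M (\<Union>i\<in>{1..n}. ?J n i) + emeasure M (\<Union>k. ?U k)"
      by (rule emeasure_subadditive[OF J_union U_union])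
    also have "emeasure M (\<Union>i\<in>{1..n}. ?J n i) \<le> (\<Sum>i\<in>{1..n}. emeasure M (?J n i))"
      using J_events by (intro emeasure_subadditive_finite) auto
    also have "\<dots> \<le> (\<Sum>i\<in>{1..n}. ennreal (K * real n powr (- \<alpha>)))"
      using J n by (intro sum_mono) auto
    also have "\<dots> = ennreal (real n * (K * real n powr (- \<alpha>)))"
      using d by (simp add: ennreal_mult ennreal_of_nat_eq_real_of_nat)
    also have "\<dots> \<le> ennreal (2 * K * real n powr (1 - \<alpha>))"
      using n d by (intro ennreal_leI) (simp add: powr_diff powr_minus divide_inverse)
    also have "emeasure M (\<Union>k. ?U k) \<le> (\<Sum>k. emeasure M (?U k))"
      by (rule emeasure_subadditive_countably) (rule image_subsetI, rule U_events)
    also have "\<dots> \<le> (\<Sum>m. ennreal (2 * K * real m powr (- \<alpha>)) * indicator {n..} m)"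
    proof (intro suminf_le)
      fix k
      show "emeasure M (?U k) \<le> ennreal (2 * K * real k powr (- \<alpha>)) * indicator {n..} k"
      proof (cases "n \<le> k")
        case True
        have "emeasure M (?T k \<union> ?J k k) \<le> emeasure M (?T k) + emeasure M (?J k k)"
          using True n J_events[of k k] T_events[of k] by (intro emeasure_subadditive) auto
        also have "\<dots> \<le> ennreal (K * real k powr (- \<alpha>)) + ennreal (K * real k powr (- \<alpha>))"
          using True n by (intro add_mono T J) auto
        also have "\<dots> = ennreal (2 * K * real k powr (- \<alpha>))"
          using d by (simp flip: ennreal_plus)
        finally show ?thesis
          using True by simp
      qed simp
    qed auto
    finally show "emeasure M {\<omega>\<in>space M. ennreal \<epsilon> < tail_max X \<alpha> p n \<omega>}
      \<le> ennreal (2 * K * real n powr (1 - \<alpha>)) + (\<Sum>m. ennreal (2 * K * real m powr (- \<alpha>)) * indicator {n..} m)"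
      by (simp add: add_mono)
  qed (use d in simp)
qed

section \<open>Summability of the exceedance probabilities and almost sure limits\<close>

lemma deviation_series_finite:
  assumes "0 < \<eta>" "1 / 2 < \<alpha> / p" "q < \<alpha> - 3"
  shows "(\<Sum>m. ennreal (real m powr (1 + q)) *
      emeasure M {\<omega>\<in>space M. tolerance \<alpha> \<eta> p m < \<bar>X m \<omega>\<bar> / real m}) < \<infinity>"
proof -
  obtain K where K: "0 \<le> K" "\<And>m. m \<ge> 1 \<Longrightarrow> emeasure M {\<omega>\<in>space M. \<eta> * real m powr (\<alpha> / p) < \<bar>X m \<omega>\<bar>}
      \<le> ennreal (K * real m powr (1 - \<alpha>))"
    using deviation_tail[OF assms(1,2)] by blast
  have "(\<Sum>m. ennreal (real m powr (1 + q)) *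
      emeasure M {\<omega>\<in>space M. tolerance \<alpha> \<eta> p m < \<bar>X m \<omega>\<bar> / real m})
    \<le> (\<Sum>m. ennreal K * ennreal (real m powr (2 + q - \<alpha>)))"
  proof (intro suminf_le)
    fix m
    show "ennreal (real m powr (1 + q)) * emeasure M {\<omega>\<in>space M. tolerance \<alpha> \<eta> p m < \<bar>X m \<omega>\<bar> / real m}
        \<le> ennreal K * ennreal (real m powr (2 + q - \<alpha>))"
    \<comment> \<open>At \<open>m = 0\<close> the weight \<open>0 powr (1 + q)\<close> vanishes, so
      the tail bound is used only for \<open>m \<ge> 1\<close>.\<close>
    proof (cases "m = 0")
      case False
      then have m: "m \<ge> 1" by simp
      have "ennreal (real m powr (1 + q)) * emeasure M {\<omega>\<in>space M. tolerance \<alpha> \<eta> p m < \<bar>X m \<omega>\<bar> / real m}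
          \<le> ennreal (real m powr (1 + q)) * ennreal (K * real m powr (1 - \<alpha>))"
        unfolding tolerance_less_iff[OF m] using K(2)[OF m] by (rule mult_left_mono) simp
      also have "\<dots> = ennreal K * ennreal (real m powr (1 + q) * real m powr (1 - \<alpha>))"
        using K(1) by (simp add: mult.left_commute flip: ennreal_mult)
      also have "real m powr (1 + q) * real m powr (1 - \<alpha>) = real m powr (2 + q - \<alpha>)"
        by (simp add: algebra_simps flip: powr_add)
      finally show ?thesis .
    qed simp
  qed auto
  also have "\<dots> = ennreal K * (\<Sum>m. ennreal (real m powr (2 + q - \<alpha>)))"
    by simp
  \<comment> \<open>The exponent \<open>2 + q - \<alpha>\<close> is below -1 exactly when
    \<open>q < \<alpha> - 3\<close>.\<close>
  also have "\<dots> < \<infinity>"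
    using assms(3) by (intro ennreal_mult_finite suminf_powr_finite) simp
  finally show ?thesis .
qed

text \<open>The direct term has exponent \<open>q + (1 - \<alpha>)\<close>; interchanging sums in
  the tail term gives \<open>(1 + q) - \<alpha>\<close>. Both contribute the same series, finite
  because \<open>q < \<alpha> - 2\<close>.\<close>

lemma tail_max_series_finite:
  assumes "0 < \<epsilon>" "1 / 2 < \<alpha> / p" "0 \<le> q" "q < \<alpha> - 2"
  shows "(\<Sum>n. ennreal (real n powr q) * indicator {1..} n *
      emeasure M {\<omega>\<in>space M. ennreal \<epsilon> < tail_max X \<alpha> p n \<omega>}) < \<infinity>"
proof -
  obtain K where K: "0 \<le> K" "\<And>n. n \<ge> 1 \<Longrightarrow> emeasure M {\<omega>\<in>space M. ennreal \<epsilon> < tail_max X \<alpha> p n \<omega>}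
      \<le> ennreal (K * real n powr (1 - \<alpha>)) + (\<Sum>m. ennreal (K * real m powr (- \<alpha>)) * indicator {n..} m)"
    using tail_max_tail[OF assms(1,2)] by blast
  let ?S = "\<Sum>n. ennreal K * ennreal (real n powr (1 + q - \<alpha>))"
  let ?t = "\<lambda>n. \<Sum>m. ennreal (K * real m powr (- \<alpha>)) * indicator {n..} m"
  have "(\<Sum>n. ennreal (real n powr q) * indicator {1..} n *
      emeasure M {\<omega>\<in>space M. ennreal \<epsilon> < tail_max X \<alpha> p n \<omega>})
    \<le> (\<Sum>n. ennreal K * ennreal (real n powr (1 + q - \<alpha>)) + ennreal (real n powr q) * indicator {1..} n * ?t n)"
  proof (intro suminf_le)
    fix n
    show "ennreal (real n powr q) * indicator {1..} n * emeasure M {\<omega>\<in>space M. ennreal \<epsilon> < tail_max X \<alpha> p n \<omega>}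
        \<le> ennreal K * ennreal (real n powr (1 + q - \<alpha>)) + ennreal (real n powr q) * indicator {1..} n * ?t n"
    proof (cases "n = 0")
      case False
      then have n: "n \<ge> 1" by simp
      have "ennreal (real n powr q) * emeasure M {\<omega>\<in>space M. ennreal \<epsilon> < tail_max X \<alpha> p n \<omega>}
          \<le> ennreal (real n powr q) * (ennreal (K * real n powr (1 - \<alpha>)) + ?t n)"
        using K(2)[OF n] by (rule mult_left_mono) simp
      also have "\<dots> = ennreal (real n powr q) * ennreal (K * real n powr (1 - \<alpha>)) + ennreal (real n powr q) * ?t n"
        by (rule distrib_left)
      also have "ennreal (real n powr q) * ennreal (K * real n powr (1 - \<alpha>))
          = ennreal K * ennreal (real n powr q * real n powr (1 - \<alpha>))"
        using K(1) by (simp add: mult.left_commute flip: ennreal_mult)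
      also have "real n powr q * real n powr (1 - \<alpha>) = real n powr (1 + q - \<alpha>)"
        by (simp add: algebra_simps flip: powr_add)
      finally show ?thesis
        using n by simp
    qed simp
  qed auto
  also have "\<dots> = ?S + (\<Sum>n. ennreal (real n powr q) * indicator {1..} n * ?t n)"
    by (rule suminf_add[symmetric]) auto
  also have "\<dots> \<le> ?S + (\<Sum>m. ennreal (real m powr (1 + q)) * ennreal (K * real m powr (- \<alpha>)))"
    by (intro add_left_mono suminf_powr_tail_le assms)
  also have "(\<Sum>m. ennreal (real m powr (1 + q)) * ennreal (K * real m powr (- \<alpha>))) = ?S"
    using K(1) by (intro suminf_cong) (simp add: mult.left_commute flip: ennreal_mult powr_add)
  also have "?S < \<infinity>"
    unfolding ennreal_suminf_cmult using assms(4) by (intro ennreal_mult_finite suminf_powr_finite) simp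
  then have "?S + ?S < \<infinity>"
    by (simp only: infinity_ennreal_def ennreal_add_less_top)
  finally show ?thesis .
qed

lemma AE_eventually_deviation_le:
  assumes "0 < \<eta>" "1 / 2 < \<alpha> / p" "3 < \<alpha>"
  shows "AE \<omega> in M. \<forall>\<^sub>F n in sequentially. \<bar>X n \<omega>\<bar> / real n \<le> tolerance \<alpha> \<eta> p n"
proof -
  let ?P = "\<lambda>n \<omega>. tolerance \<alpha> \<eta> p n < \<bar>X n \<omega>\<bar> / real n"
  \<comment> \<open>For \<open>n \<ge> 1\<close> the weight is at least 1, so the weighted series
    with \<open>q = 0\<close> dominates the plain one.\<close>
  have "(\<Sum>n. indicator {1..} n * emeasure M {\<omega>\<in>space M. ?P n \<omega>})
      \<le> (\<Sum>n. ennreal (real n powr (1 + 0)) * emeasure M {\<omega>\<in>space M. ?P n \<omega>})"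
    by (intro suminf_le mult_right_mono) (auto split: split_indicator)
  also have "\<dots> < \<infinity>"
    using deviation_series_finite[of \<eta> \<alpha> 0] assms by simp
  finally have "AE \<omega> in M. \<forall>\<^sub>F n in sequentially. \<not> ?P n \<omega>"
    by (intro Borel_Cantelli_suminf) measurable
  then show ?thesis
    by (simp add: not_less)
qed

text \<open>The eventual bound holds for every positive factor in the tolerance. Applying it to
  \<open>\<eta> / (j + 1)\<close> for all \<open>j\<close>, outside a countable union of null sets,
  turns it into convergence to 0.\<close>

lemma AE_deviation_tendsto_0:
  assumes "0 < \<eta>" "1 / 2 < \<alpha> / p" "3 < \<alpha>"
  shows "AE \<omega> in M. (\<lambda>n. \<bar>X n \<omega> / real n\<bar> * inverse (\<eta> * real n powr (\<alpha> / p - 1))) \<longlonglongrightarrow> 0"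
proof -
  have "AE \<omega> in M. \<forall>j. \<forall>\<^sub>F n in sequentially. \<bar>X n \<omega>\<bar> / real n \<le> tolerance \<alpha> (\<eta> * inverse (real (Suc j))) p n"
    unfolding AE_all_countable using assms by (intro allI AE_eventually_deviation_le) auto
  then show ?thesis
  proof eventually_elim
    case (elim \<omega>)
    show ?case
    proof (rule tendstoI)
      fix e :: real assume "0 < e"
      then obtain j where j: "inverse (real (Suc j)) < e"
        using reals_Archimedean by blast
      from elim have "\<forall>\<^sub>F n in sequentially. \<bar>X n \<omega>\<bar> / real n \<le> tolerance \<alpha> (\<eta> * inverse (real (Suc j))) p n"
        by blast
      with eventually_gt_at_top[of 0]
      show "\<forall>\<^sub>F n in sequentially. dist (\<bar>X n \<omega> / real n\<bar> * inverse (\<eta> * real n powr (\<alpha> / p - 1))) 0 < e"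
      proof eventually_elim
        case (elim n)
        let ?b = "\<eta> * real n powr (\<alpha> / p - 1)"
        have b: "0 < ?b"
          using elim(1) assms(1) by simp
        have "\<bar>X n \<omega> / real n\<bar> \<le> inverse (real (Suc j)) * ?b"
          using elim(2) by (simp add: tolerance_def mult.assoc mult.left_commute)
        then have "\<bar>X n \<omega> / real n\<bar> * inverse ?b \<le> inverse (real (Suc j)) * ?b * inverse ?b"
          by (rule mult_right_mono[OF _ less_imp_le[OF positive_imp_inverse_positive[OF b]]])
        also have "\<dots> = inverse (real (Suc j))"
          by (simp only: mult.assoc[of "inverse (real (Suc j))"] right_inverse[OF less_imp_neq[OF b, symmetric]] mult_1_right)
        finally have "\<bar>X n \<omega> / real n\<bar> * inverse ?b < e"
          using j by (rule le_less_trans)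
        moreover have "0 \<le> \<bar>X n \<omega> / real n\<bar> * inverse ?b"
          by (rule mult_nonneg_nonneg[OF abs_ge_zero less_imp_le[OF positive_imp_inverse_positive[OF b]]])
        ultimately show ?case
          unfolding dist_real_def by linarith
      qed
    qed
  qed
qed

text \<open>The limit exists as an infimum because tail suprema decrease in \<open>n\<close>; by
  Borel-Cantelli a single index with value at most \<open>\<epsilon>\<close> is available, which
  bounds the infimum.\<close>

lemma AE_tail_max_limit:
  assumes "0 < \<epsilon>" "1 / 2 < \<alpha> / p" "2 < \<alpha>"
  shows "AE \<omega> in M. \<exists>L. (\<lambda>n. tail_max X \<alpha> p n \<omega>) \<longlonglongrightarrow> L \<and> L \<le> ennreal \<epsilon>"
proof -
  let ?P = "\<lambda>n \<omega>. ennreal \<epsilon> < tail_max X \<alpha> p n \<omega>"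
  have [measurable]: "Measurable.pred M (?P n)" for n
    unfolding tail_max_def by measurable
  have "(\<Sum>n. indicator {1..} n * emeasure M {\<omega>\<in>space M. ?P n \<omega>})
      = (\<Sum>n. ennreal (real n powr 0) * indicator {1..} n * emeasure M {\<omega>\<in>space M. ?P n \<omega>})"
    by (intro suminf_cong) (auto split: split_indicator)
  also have "\<dots> < \<infinity>"
    using tail_max_series_finite[of \<epsilon> \<alpha> 0] assms by simp
  finally have "AE \<omega> in M. \<forall>\<^sub>F n in sequentially. \<not> ?P n \<omega>"
    by (intro Borel_Cantelli_suminf) measurable
  then show ?thesis
  proof eventually_elim
    case (elim \<omega>)
    have "(\<lambda>n. tail_max X \<alpha> p n \<omega>) \<longlonglongrightarrow> (INF n. tail_max X \<alpha> p n \<omega>)"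
      by (intro LIMSEQ_INF decseq_SucI tail_max_antimono) simp
    moreover obtain n where "\<not> ?P n \<omega>"
      using elim by (auto simp: eventually_sequentially)
    then have "(INF n. tail_max X \<alpha> p n \<omega>) \<le> ennreal \<epsilon>"
      by (intro INF_lower2[of n]) (auto simp: not_less)
    ultimately show ?case
      by blast
  qed
qed

end

section \<open>Choice of the constant and assembly of parts (a) and (b)\<close>

theorem corollary2:
  fixes M :: "'a measure" and \<Delta> :: "nat \<Rightarrow> 'a \<Rightarrow> real" and X :: "nat \<Rightarrow> 'a \<Rightarrow> real"
    and n\<^sub>0 :: nat and p :: real
  assumes prob: "prob_space M"
    and indep: "prob_space.indep_vars M (\<lambda>_. borel) \<Delta> {1..}"
    and ident: "\<And>n. n \<ge> 1 \<Longrightarrow> distr M borel (\<Delta> n) = distr M borel (\<Delta> 1)"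
    and centered: "\<And>n. n \<ge> 1 \<Longrightarrow> integrable M (\<Delta> n) \<and> integral\<^sup>L M (\<Delta> n) = 0"
    and X: "X = partial_sum \<Delta>"
    and n0: "n\<^sub>0 \<ge> 1"
    and p: "p > 3"
    and moment: "integrable M (\<lambda>\<omega>. \<bar>\<Delta> 1 \<omega>\<bar> powr p)"
  shows
    "(\<forall>\<eta> \<alpha> p'. \<eta> > 0 \<and> \<alpha> > 3 \<and> 1 / 2 < \<alpha> / p \<and> \<alpha> / p \<le> 1 \<and> 0 \<le> p' \<and> p' < \<alpha> - 3 \<longrightarrow>
      (\<exists>C>0.
        (\<Sum>\<^sub>\<infinity>n\<in>{n\<^sub>0..}. ennreal (real n powr p') *
            (\<Sum>\<^sub>\<infinity>m\<in>{n..}. emeasure M {\<omega> \<in> space M. \<bar>X m \<omega>\<bar> / real m > tolerance \<alpha> \<eta> p m}))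
          \<le> ennreal (C * (\<alpha> - 1)) * hurwitz_zeta (\<alpha> - 2 - p') n\<^sub>0 \<and>
        ennreal (C * (\<alpha> - 1)) * hurwitz_zeta (\<alpha> - 2 - p') n\<^sub>0 < \<infinity> \<and>
        (AE \<omega> in M. (\<lambda>n. \<bar>X n \<omega> / real n\<bar> * inverse (\<eta> * real n powr (\<alpha> / p - 1))) \<longlonglongrightarrow> 0) \<and>
        (\<integral>\<^sup>+\<omega>. ennreal_powr (overlap_count X \<alpha> \<eta> p n\<^sub>0 \<omega>) (1 + p') \<partial>M)
          \<le> (\<integral>\<^sup>+\<omega>. ennreal_powr (last_overlap X \<alpha> \<eta> p n\<^sub>0 \<omega>) (1 + p') \<partial>M) \<and>
        (\<integral>\<^sup>+\<omega>. ennreal_powr (last_overlap X \<alpha> \<eta> p n\<^sub>0 \<omega>) (1 + p') \<partial>M)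
          \<le> ennreal (C * (\<alpha> - 1)) * hurwitz_zeta (\<alpha> - 2 - p') n\<^sub>0 \<and>
        (\<forall>k::nat. k \<ge> 1 \<longrightarrow>
          emeasure M {\<omega> \<in> space M. overlap_count X \<alpha> \<eta> p n\<^sub>0 \<omega> \<ge> of_nat k}
            \<le> emeasure M {\<omega> \<in> space M. last_overlap X \<alpha> \<eta> p n\<^sub>0 \<omega> \<ge> of_nat k} \<and>
          emeasure M {\<omega> \<in> space M. last_overlap X \<alpha> \<eta> p n\<^sub>0 \<omega> \<ge> of_nat k}
            \<le> ennreal (real k powr (- (1 + p')) * (C * (\<alpha> - 1))) *
                hurwitz_zeta (\<alpha> - 2 - p') n\<^sub>0)))
     \<and>
     (\<forall>\<epsilon> \<alpha> p'. \<epsilon> > 0 \<and> \<alpha> > 2 \<and> 1 / 2 < \<alpha> / p \<and> \<alpha> / p \<le> 1 \<and> 0 \<le> p' \<and> p' < \<alpha> - 2 \<longrightarrow>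
      (\<exists>C>0.
        (\<Sum>\<^sub>\<infinity>n\<in>{1..}. ennreal (real n powr p') *
            emeasure M {\<omega> \<in> space M. tail_max X \<alpha> p n \<omega> > ennreal \<epsilon>})
          \<le> ennreal C * hurwitz_zeta (\<alpha> - 1 - p') n\<^sub>0 \<and>
        ennreal C * hurwitz_zeta (\<alpha> - 1 - p') n\<^sub>0 < \<infinity> \<and>
        (AE \<omega> in M. \<exists>L. (\<lambda>n. tail_max X \<alpha> p n \<omega>) \<longlonglongrightarrow> L \<and> L \<le> ennreal \<epsilon>) \<and>
        (\<integral>\<^sup>+\<omega>. ennreal_powr (tail_overlap_count X \<alpha> p \<epsilon> n\<^sub>0 \<omega>) (1 + p') \<partial>M)
          \<le> (\<integral>\<^sup>+\<omega>. ennreal_powr (last_tail_overlap X \<alpha> p \<epsilon> n\<^sub>0 \<omega>) (1 + p') \<partial>M) \<and>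
        (\<integral>\<^sup>+\<omega>. ennreal_powr (last_tail_overlap X \<alpha> p \<epsilon> n\<^sub>0 \<omega>) (1 + p') \<partial>M)
          \<le> ennreal C * hurwitz_zeta (\<alpha> - 1 - p') n\<^sub>0 \<and>
        (\<forall>k::nat. k \<ge> 1 \<longrightarrow>
          emeasure M {\<omega> \<in> space M. tail_overlap_count X \<alpha> p \<epsilon> n\<^sub>0 \<omega> \<ge> of_nat k}
            \<le> emeasure M {\<omega> \<in> space M. last_tail_overlap X \<alpha> p \<epsilon> n\<^sub>0 \<omega> \<ge> of_nat k} \<and>
          emeasure M {\<omega> \<in> space M. last_tail_overlap X \<alpha> p \<epsilon> n\<^sub>0 \<omega> \<ge> of_nat k}
            \<le> ennreal (real k powr (- (p' + 1)) * C) * hurwitz_zeta (\<alpha> - 1 - p') n\<^sub>0)))"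
proof -
  interpret iid_walk M \<Delta> X p
    by (intro iid_walk.intro iid_walk_axioms.intro prob indep ident centered X moment) (use p in simp_all)
  show ?thesis
  proof (intro conjI allI impI, goal_cases)
    case (1 \<eta> \<alpha> p')
    then have h: "0 < \<eta>" "3 < \<alpha>" "1 / 2 < \<alpha> / p" "0 \<le> p'" "p' < \<alpha> - 3"
      by blast+
    let ?P = "\<lambda>n \<omega>. tolerance \<alpha> \<eta> p n < \<bar>X n \<omega>\<bar> / real n"
    let ?S = "\<Sum>m. ennreal (real m powr (1 + p')) * emeasure M {\<omega>\<in>space M. ?P m \<omega>}"
    let ?z = "hurwitz_zeta (\<alpha> - 2 - p') n\<^sub>0"
    have P: "Measurable.pred M (?P n)" for n
      by measurable
    have z: "?z < \<infinity>"
      using h by (intro hurwitz_zeta_finite) simp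
    \<comment> \<open>One \<open>C\<close> suffices because \<open>?S\<close> dominates both the
      double series and the moment of the last exceedance; the tail probabilities follow by
      Markov.\<close>
    obtain C where C: "0 < C" "?S \<le> ennreal (C * (\<alpha> - 1)) * ?z"
      using obtain_ennreal_factor[OF deviation_series_finite[OF h(1,3,5)] hurwitz_zeta_pos[OF n0], of "\<alpha> - 1" "\<alpha> - 2 - p'"] h
      by auto
    have E: "(\<integral>\<^sup>+\<omega>. ennreal_powr (max_from n\<^sub>0 (\<lambda>n. ?P n \<omega>)) (1 + p') \<partial>M) \<le> ennreal (C * (\<alpha> - 1)) * ?z"
      using h by (intro order_trans[OF max_from_moment_le[OF P n0] C(2)]) simp
    have c: "0 \<le> C * (\<alpha> - 1)" and a: "0 \<le> 1 + p'"
      using C h by auto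
    show ?case
      unfolding overlap_count_def last_overlap_def
      using C(1) order_trans[OF infsum_tails_le[OF h(4) n0] C(2)] z
        AE_deviation_tendsto_0[OF h(1,3,2)] count_from_moment_le[OF n0 a] E
        emeasure_count_from_ge_le[OF P n0] emeasure_max_from_ge_le[OF P a _ c E]
      by (intro exI[of _ C] conjI allI impI) (auto simp: ennreal_mult_less_top)
  next
    case (2 \<epsilon> \<alpha> p')
    then have h: "0 < \<epsilon>" "2 < \<alpha>" "1 / 2 < \<alpha> / p" "0 \<le> p'" "p' < \<alpha> - 2"
      by blast+
    let ?P = "\<lambda>n \<omega>. ennreal \<epsilon> < tail_max X \<alpha> p n \<omega>"
    let ?S = "\<Sum>n. ennreal (real n powr p') * indicator {1..} n * emeasure M {\<omega>\<in>space M. ?P n \<omega>}"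
    let ?z = "hurwitz_zeta (\<alpha> - 1 - p') n\<^sub>0"
    have P: "Measurable.pred M (?P n)" for n
      unfolding tail_max_def by measurable
    have z: "?z < \<infinity>"
      using h by (intro hurwitz_zeta_finite) simp
    \<comment> \<open>The moment bound carries the factor \<open>1 + p'\<close>, so \<open>C\<close>
      is chosen for this larger quantity; as \<open>1 + p' \<ge> 1\<close>, it also bounds the plain
      series.\<close>
    have "ennreal (1 + p') * ?S < \<infinity>"
      by (rule ennreal_mult_finite[OF tail_max_series_finite[OF h(1,3,4,5)]])
    then obtain C where C: "0 < C" "ennreal (1 + p') * ?S \<le> ennreal C * ?z"
      using obtain_ennreal_factor[OF _ hurwitz_zeta_pos[OF n0], of _ 1 "\<alpha> - 1 - p'"] by auto
    have "1 * ?S \<le> ennreal (1 + p') * ?S"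
      using h by (intro mult_right_mono) auto
    moreover have "(\<Sum>\<^sub>\<infinity>n\<in>{1..}. ennreal (real n powr p') * emeasure M {\<omega>\<in>space M. ?P n \<omega>}) = ?S"
      unfolding infsum_ennreal_eq_suminf by (simp add: mult_ac)
    ultimately have S: "(\<Sum>\<^sub>\<infinity>n\<in>{1..}. ennreal (real n powr p') * emeasure M {\<omega>\<in>space M. ?P n \<omega>}) \<le> ennreal C * ?z"
      using C(2) by simp
    \<comment> \<open>Tail suprema decrease in \<open>n\<close>, so exceedances are closed downwards
      and the sharper moment bound applies.\<close>
    have E: "(\<integral>\<^sup>+\<omega>. ennreal_powr (max_from n\<^sub>0 (\<lambda>n. ?P n \<omega>)) (1 + p') \<partial>M) \<le> ennreal C * ?z"
      using less_le_trans[OF _ tail_max_antimono]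
      by (intro order_trans[OF max_from_moment_le_decreasing[OF P h(4)] C(2)])
    have c: "0 \<le> C" and a: "0 \<le> 1 + p'"
      using C h by auto
    show ?case
      unfolding tail_overlap_count_def last_tail_overlap_def add.commute[of p' 1]
      using C(1) S z AE_tail_max_limit[OF h(1,3,2)] count_from_moment_le[OF n0 a] E
        emeasure_count_from_ge_le[OF P n0] emeasure_max_from_ge_le[OF P a _ c E]
      by (intro exI[of _ C] conjI allI impI) (auto simp: ennreal_mult_less_top)
  qed
qed

end
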